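(* Let $f$ be a strictly convex continuous (real-valued) function on an interval $I\subset\mathbb{R}$, let $\mathcal{H}$ be a Hilbert space, and let $(H_i)$ be a net in $B(\mathcal{H})_{\mathrm{sa}}$ such that $\sigma(H_i)\subset I$ for all $i$. If $(H_i)$ converges weakly to a bounded operator $H$ with $\sigma(H)\subset I$, and if also $(f(H_i))$ converges weakly to $f(H)$, then $(\varphi(H_i))$ converges strongly to $\varphi(H)$ for every bounded continuous function $\varphi$ on $I$. In particular, if the net $(H_i)$ is bounded (in operator norm), then $(H_i)$ converges strongly to $H$.
   Context: $B(\mathcal{H})$ is the algebra of bounded linear operators on the Hilbert space $\mathcal{H}$ and $B(\mathcal{H})_{\mathrm{sa}}$ its set of self-adjoint elements; $\sigma(\cdot)$ is the spectrum. Functions of self-adjoint operators are defined by the continuous functional calculus. "Weakly" and "strongly" refer to the weak operator topology and the strong operator topology. The interval $I$ need not be compact, and the net $(H_i)$ is not assumed bounded except where stated. *)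

theory Defs
  imports "HOL-Analysis.Analysis"
begin

section \<open>Complex Hilbert spaces\<close>

text \<open>
  A complex Hilbert space is presented as a complete real inner product space together with a
  compatible complex structure: the real inner product is the real part of the complex one, so
  that \<^prop>\<open>(norm x)\<^sup>2 = Re (cinner x x)\<close>, and the norm, metric and topology are those of the
  complex inner product.  The complex inner product is antilinear in its first argument.
\<close>

class chilbert_space = real_inner + complete_space +
  fixes scaleC :: "complex \<Rightarrow> 'a \<Rightarrow> 'a" (infixr \<open>*\<^sub>C\<close> 75)
    and cinner :: "'a \<Rightarrow> 'a \<Rightarrow> complex"
  assumes scaleC_add_right: "c *\<^sub>C (x + y) = c *\<^sub>C x + c *\<^sub>C y"
    and scaleC_add_left: "(c + d) *\<^sub>C x = c *\<^sub>C x + d *\<^sub>C x"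
    and scaleC_scaleC: "c *\<^sub>C (d *\<^sub>C x) = (c * d) *\<^sub>C x"
    and scaleC_of_real: "complex_of_real r *\<^sub>C x = r *\<^sub>R x"
    and cinner_commute: "cinner x y = cnj (cinner y x)"
    and cinner_add_right: "cinner x (y + z) = cinner x y + cinner x z"
    and cinner_scaleC_right: "cinner x (c *\<^sub>C y) = c * cinner x y"
    and Re_cinner: "Re (cinner x y) = x \<bullet> y"

instantiation complex :: chilbert_space
begin

definition scaleC_complex :: "complex \<Rightarrow> complex \<Rightarrow> complex"
  where "scaleC_complex c x = c * x"

definition cinner_complex :: "complex \<Rightarrow> complex \<Rightarrow> complex"
  where "cinner_complex x y = cnj x * y"

instance
  by standard
    (simp_all add: scaleC_complex_def cinner_complex_def inner_complex_def
      scaleR_conv_of_real algebra_simps)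

end

section \<open>Bounded operators\<close>

text \<open>
  The library type of bounded operators only requires real linearity;
  \<open>B(\<H>)\<close> is the set of those which are complex linear.  The library's operator norm is the usual
  one, since it only involves the norm of \<open>\<H>\<close>.
\<close>

definition bounded_ops :: "('a::chilbert_space \<Rightarrow>\<^sub>L 'a) set"
  where "bounded_ops = {T. \<forall>c x. blinfun_apply T (c *\<^sub>C x) = c *\<^sub>C blinfun_apply T x}"

definition is_adjoint :: "('a::chilbert_space \<Rightarrow>\<^sub>L 'a) \<Rightarrow> ('a \<Rightarrow>\<^sub>L 'a) \<Rightarrow> bool"
  where "is_adjoint T S \<longleftrightarrow>
    (\<forall>x y. cinner (blinfun_apply T x) y = cinner x (blinfun_apply S y))"

definition selfadjoint_ops :: "('a::chilbert_space \<Rightarrow>\<^sub>L 'a) set"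
  where "selfadjoint_ops = {T \<in> bounded_ops. is_adjoint T T}"

definition spectrum :: "('a::chilbert_space \<Rightarrow>\<^sub>L 'a) \<Rightarrow> complex set"
  where "spectrum T =
    {z. \<not> (\<exists>S\<in>bounded_ops. \<forall>x.
            blinfun_apply S (blinfun_apply T x - z *\<^sub>C x) = x \<and>
            blinfun_apply T (blinfun_apply S x) - z *\<^sub>C blinfun_apply S x = x)}"

section \<open>Continuous functional calculus\<close>

text \<open>
  \<open>is_cfc T \<Phi>\<close> says that \<open>\<Phi>\<close> is a unital \<open>*\<close>-homomorphism from \<open>C(\<sigma>(T))\<close> to \<open>B(\<H>)\<close> which maps the
  identity function to \<open>T\<close>.  An element of \<open>C(\<sigma>(T))\<close> is represented by any function on the reals
  whose restriction to \<open>\<sigma>(T)\<close> it is (the spectrum of a self-adjoint operator being real), and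
  \<open>\<Phi>\<close> is required to depend on that restriction only.
\<close>

definition real_spectrum :: "('a::chilbert_space \<Rightarrow>\<^sub>L 'a) \<Rightarrow> real set"
  where "real_spectrum T = {t. complex_of_real t \<in> spectrum T}"

definition is_cfc ::
    "('a::chilbert_space \<Rightarrow>\<^sub>L 'a) \<Rightarrow> ((real \<Rightarrow> complex) \<Rightarrow> ('a \<Rightarrow>\<^sub>L 'a)) \<Rightarrow> bool"
  where "is_cfc T \<Phi> \<longleftrightarrow>
    (let C = {g. continuous_on (real_spectrum T) g} in
      (\<forall>g\<in>C. \<Phi> g \<in> bounded_ops) \<and>
      (\<forall>g\<in>C. \<forall>h\<in>C. (\<forall>t\<in>real_spectrum T. g t = h t) \<longrightarrow> \<Phi> g = \<Phi> h) \<and>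
      (\<forall>g\<in>C. \<forall>h\<in>C. \<Phi> (\<lambda>t. g t + h t) = \<Phi> g + \<Phi> h) \<and>
      (\<forall>g\<in>C. \<forall>c x. blinfun_apply (\<Phi> (\<lambda>t. c * g t)) x = c *\<^sub>C blinfun_apply (\<Phi> g) x) \<and>
      (\<forall>g\<in>C. \<forall>h\<in>C. \<Phi> (\<lambda>t. g t * h t) = \<Phi> g o\<^sub>L \<Phi> h) \<and>
      (\<forall>g\<in>C. is_adjoint (\<Phi> g) (\<Phi> (\<lambda>t. cnj (g t)))) \<and>
      \<Phi> (\<lambda>_. 1) = id_blinfun \<and>
      \<Phi> complex_of_real = T)"

text \<open>
  For self-adjoint \<open>T\<close> such a \<open>\<Phi>\<close> exists and its values on \<open>C(\<sigma>(T))\<close> are unique, so that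
  \<open>cfc g T\<close> is the operator \<open>g(T)\<close> whenever \<open>g\<close> is continuous on \<open>\<sigma>(T)\<close>.
\<close>

definition cfc :: "(real \<Rightarrow> complex) \<Rightarrow> ('a::chilbert_space \<Rightarrow>\<^sub>L 'a) \<Rightarrow> ('a \<Rightarrow>\<^sub>L 'a)"
  where "cfc g T = (THE S. \<exists>\<Phi>. is_cfc T \<Phi> \<and> S = \<Phi> g)"

section \<open>Weak operator topology\<close>

text \<open>The initial topology for the maps \<open>T \<mapsto> \<langle>x, T y\<rangle>\<close>; compare the library's
  \<^const>\<open>strong_operator_topology\<close>.\<close>

definition weak_operator_topology :: "('a::chilbert_space \<Rightarrow>\<^sub>L 'a) topology"
  where "weak_operator_topology =
    pullback_topology UNIV (\<lambda>T (x, y). cinner x (blinfun_apply T y)) euclidean"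

lemma limitin_pullback_UNIV:
  "limitin (pullback_topology UNIV f X) u l F \<longleftrightarrow> limitin X (\<lambda>i. f (u i)) (f l) F"
  by (auto simp: limitin_def topspace_pullback_topology openin_pullback_topology)

lemma limitin_weak_operator_topology_iff:
  "limitin weak_operator_topology A B F \<longleftrightarrow>
    (\<forall>x y. ((\<lambda>i. cinner x (blinfun_apply (A i) y)) \<longlongrightarrow> cinner x (blinfun_apply B y)) F)"
  unfolding weak_operator_topology_def limitin_pullback_UNIV
  by (subst euclidean_product_topology [symmetric])
    (simp only: limitin_componentwise, auto)

lemma limitin_strong_operator_topology_iff:
  "limitin strong_operator_topology A B F \<longleftrightarrow>
    (\<forall>x. ((\<lambda>i. blinfun_apply (A i) x) \<longlongrightarrow> blinfun_apply B x) F)"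
  unfolding strong_operator_topology_def limitin_pullback_UNIV
  by (subst euclidean_product_topology [symmetric])
    (simp only: limitin_componentwise, auto)

section \<open>Nets\<close>

text \<open>
  A net is a family indexed by a directed set \<open>(D, le)\<close>; its convergence is convergence along the
  filter generated by the tails of \<open>D\<close>.
\<close>

definition directed_set :: "'i set \<Rightarrow> ('i \<Rightarrow> 'i \<Rightarrow> bool) \<Rightarrow> bool"
  where "directed_set D le \<longleftrightarrow> D \<noteq> {} \<and>
    (\<forall>i\<in>D. le i i) \<and>
    (\<forall>i\<in>D. \<forall>j\<in>D. \<forall>k\<in>D. le i j \<longrightarrow> le j k \<longrightarrow> le i k) \<and>
    (\<forall>i\<in>D. \<forall>j\<in>D. \<exists>k\<in>D. le i k \<and> le j k)"

definition net_filter :: "'i set \<Rightarrow> ('i \<Rightarrow> 'i \<Rightarrow> bool) \<Rightarrow> 'i filter"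
  where "net_filter D le = (INF i\<in>D. principal {j \<in> D. le i j})"

lemma eventually_net_filter:
  assumes "directed_set D le"
  shows "eventually P (net_filter D le) \<longleftrightarrow> (\<exists>i\<in>D. \<forall>j\<in>D. le i j \<longrightarrow> P j)"
proof -
  have ne: "D \<noteq> {}"
    and trans_D: "\<forall>i\<in>D. \<forall>j\<in>D. \<forall>k\<in>D. le i j \<longrightarrow> le j k \<longrightarrow> le i k"
    and ub_D: "\<forall>i\<in>D. \<forall>j\<in>D. \<exists>k\<in>D. le i k \<and> le j k"
    using assms unfolding directed_set_def by blast+
  note trans = trans_D [rule_format] and ub = ub_D [rule_format]
  have "\<exists>k\<in>D. principal {l \<in> D. le k l} \<le>
      inf (principal {l \<in> D. le i l}) (principal {l \<in> D. le j l})"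
    if ij: "i \<in> D" "j \<in> D" for i j
  proof -
    obtain k where k: "k \<in> D" "le i k" "le j k"
      using ub [OF ij] by (elim bexE conjE) (rule that)
    have "{l \<in> D. le k l} \<subseteq> {l \<in> D. le i l} \<inter> {l \<in> D. le j l}"
      using trans [OF ij(1) k(1) _ k(2)] trans [OF ij(2) k(1) _ k(3)] by blast
    with k(1) show ?thesis
      by (intro bexI [of _ k]) (simp_all only: inf_principal principal_le_iff)
  qed
  with ne have "eventually P (net_filter D le) \<longleftrightarrow>
      (\<exists>i\<in>D. eventually P (principal {j \<in> D. le i j}))"
    unfolding net_filter_def by (intro eventually_INF_base)
  then show ?thesis unfolding eventually_principal by blast
qed

section \<open>Strict convexity\<close>

definition strictly_convex_on :: "real set \<Rightarrow> (real \<Rightarrow> real) \<Rightarrow> bool"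
  where "strictly_convex_on I f \<longleftrightarrow> convex I \<and>
    (\<forall>x\<in>I. \<forall>y\<in>I. \<forall>u. x \<noteq> y \<longrightarrow> 0 < u \<longrightarrow> u < 1 \<longrightarrow>
      f ((1 - u) * x + u * y) < (1 - u) * f x + u * f y)"

end

theory Submission
  imports Defs "HOL-Computational_Algebra.Fundamental_Theorem_Algebra"
begin

text \<open>
  Since \<open>\<parallel>\<phi>(H\<^sub>i) x\<parallel>\<^sup>2 = \<langle>x, \<phi>\<^sup>2(H\<^sub>i) x\<rangle>\<close> for real \<open>\<phi>\<close>, it suffices that \<open>\<phi>(H\<^sub>i)\<close> converges weakly for
  every bounded continuous real \<open>\<phi>\<close>.  The core is that \<open>v(H\<^sub>i) u(H)\<close> tends strongly to \<open>0\<close> when \<open>u\<close>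
  and \<open>v\<close> have separated supports.  To see this, cut \<open>u(H) x\<close> by a partition of unity into pieces
  \<open>y\<^sub>k\<close> living near grid points \<open>s\<^sub>k\<close> and let \<open>g\<^sub>k \<ge> 0\<close> be \<open>f\<close> minus its support line at \<open>s\<^sub>k\<close>.  By
  strict convexity \<open>v\<^sup>2 \<le> C g\<^sub>k\<close> with \<open>C\<close> independent of the grid, so the limit superior of
  \<open>\<parallel>v(H\<^sub>i) y\<^sub>k\<parallel>\<^sup>2\<close> is at most \<open>C \<langle>y\<^sub>k, g\<^sub>k(H) y\<^sub>k\<rangle> \<le> C e\<^sub>k \<parallel>y\<^sub>k\<parallel>\<^sup>2\<close>, where \<open>e\<^sub>k\<close> is a second difference of
  \<open>f\<close>.  The \<open>e\<^sub>k\<close> telescope to something that tends to \<open>0\<close> as the grid is refined, and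
  Cauchy-Schwarz allows the pieces to be summed.  Writing \<open>\<phi>\<close> as an average of layers \<open>0 \<le> \<phi>\<^sub>j \<le> 1\<close>
  such that \<open>\<phi>\<^sub>j = 1\<close> on the support of \<open>\<phi>\<^sub>j\<^sub>+\<^sub>1\<close> then turns this into weak convergence.

  The functional calculus itself is obtained from \<open>\<parallel>p(T)\<parallel> \<le> sup |p|\<close> on the spectrum: approximate
  maximisers of \<open>\<parallel>p(T) x\<parallel>\<close> are approximate eigenvectors of \<open>p(T)\<^sup>* p(T)\<close>, and factoring the polynomial
  \<open>|p|\<^sup>2 - \<parallel>p(T)\<parallel>\<^sup>2\<close> over \<open>\<complex>\<close> yields a point of the spectrum where it vanishes.
\<close>

instance chilbert_space \<subseteq> banach ..

section \<open>Complex scaling and adjoints\<close>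

lemma scaleC_zero_left [simp]: "0 *\<^sub>C (x::'a::chilbert_space) = 0"
  using scaleC_of_real [of 0 x] by simp

lemma scaleC_one [simp]: "1 *\<^sub>C (x::'a::chilbert_space) = x"
  using scaleC_of_real [of 1 x] by simp

lemma scaleC_zero_right [simp]: "c *\<^sub>C (0::'a::chilbert_space) = 0"
  using scaleC_add_right [of c 0 "0::'a"] by simp

lemma scaleC_minus_left: "(- c) *\<^sub>C (x::'a::chilbert_space) = - (c *\<^sub>C x)"
  using scaleC_add_left [of "- c" c x] by (simp add: eq_neg_iff_add_eq_0)

lemma scaleC_minus_right: "c *\<^sub>C (- x::'a::chilbert_space) = - (c *\<^sub>C x)"
  using scaleC_add_right [of c "- x" x] by (simp add: eq_neg_iff_add_eq_0)

lemma scaleC_diff_right: "c *\<^sub>C (x - y::'a::chilbert_space) = c *\<^sub>C x - c *\<^sub>C y"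
  using scaleC_add_right [of c x "- y"] by (simp add: scaleC_minus_right)

lemma scaleC_scaleR: "c *\<^sub>C (r *\<^sub>R (x::'a::chilbert_space)) = r *\<^sub>R (c *\<^sub>C x)"
  by (simp add: scaleC_scaleC mult.commute flip: scaleC_of_real)

lemma cinner_scaleC_left: "cinner (c *\<^sub>C x) y = cnj c * cinner (x::'a::chilbert_space) y"
  by (metis cinner_commute cinner_scaleC_right complex_cnj_mult)

lemma cinner_self: "cinner x x = complex_of_real ((norm (x::'a::chilbert_space))\<^sup>2)"
proof -
  have "Im (cinner x x) = 0"
    using cinner_commute [of x x] by (metis complex_cnj_cancel_iff cnj.simps(2) equal_neg_zero)
  then show ?thesis
    by (simp add: complex_eq_iff Re_cinner dot_square_norm)
qed

text \<open>Multiplying the second argument by -i moves the imaginary part of \<open>cinner\<close>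
  into its real part, so identities between complex inner products reduce to the real inner
  product.\<close>

lemma cinner_eq_Complex: "cinner x y = Complex (x \<bullet> y) (x \<bullet> ((- \<i>) *\<^sub>C (y::'a::chilbert_space)))"
  by (simp add: complex_eq_iff Re_cinner cinner_scaleC_right flip: Re_cinner)

lemma norm_scaleC: "norm (c *\<^sub>C (x::'a::chilbert_space)) = cmod c * norm x"
proof -
  have "complex_of_real ((norm (c *\<^sub>C x))\<^sup>2) = cnj c * c * complex_of_real ((norm x)\<^sup>2)"
    unfolding cinner_self [symmetric] cinner_scaleC_left cinner_scaleC_right by simp
  also have "\<dots> = complex_of_real ((cmod c * norm x)\<^sup>2)"
    using complex_norm_square [of c] by (simp add: power_mult_distrib mult.commute)
  finally have "(norm (c *\<^sub>C x))\<^sup>2 = (cmod c * norm x)\<^sup>2"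
    using of_real_eq_iff by blast
  then show ?thesis by (simp add: power2_eq_iff_nonneg)
qed

definition scale_op :: "complex \<Rightarrow> ('a::chilbert_space \<Rightarrow>\<^sub>L 'a)"
  where "scale_op c = Blinfun (\<lambda>x. c *\<^sub>C x)"

lemma scale_op_apply [simp]: "blinfun_apply (scale_op c) x = c *\<^sub>C x"
proof -
  have "bounded_linear (\<lambda>x::'a. c *\<^sub>C x)"
    by (rule bounded_linear_intro [where K = "cmod c"])
      (simp_all add: scaleC_add_right scaleC_scaleR norm_scaleC mult.commute)
  then show ?thesis
    by (simp add: scale_op_def bounded_linear_Blinfun_apply)
qed

lemma bounded_opsD: "T \<in> bounded_ops \<Longrightarrow> blinfun_apply T (c *\<^sub>C x) = c *\<^sub>C blinfun_apply T x"
  by (simp add: bounded_ops_def)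

text \<open>Complex linearity of \<open>S\<close> carries the factor -i through, so the imaginary
  part of the adjoint identity at y is its real part at -i y.\<close>

lemma is_adjoint_bounded_ops_iff:
  fixes S T :: "'a::chilbert_space \<Rightarrow>\<^sub>L 'a"
  assumes "S \<in> bounded_ops"
  shows "is_adjoint T S \<longleftrightarrow> (\<forall>x y. blinfun_apply T x \<bullet> y = x \<bullet> blinfun_apply S y)"
  unfolding is_adjoint_def cinner_eq_Complex complex.inject
  using bounded_opsD [OF assms] by metis

lemma is_adjointD: "is_adjoint T S \<Longrightarrow> blinfun_apply T x \<bullet> y = x \<bullet> blinfun_apply S y"
  unfolding is_adjoint_def by (metis Re_cinner)

lemma norm_adjoint_le:
  fixes S T :: "'a::chilbert_space \<Rightarrow>\<^sub>L 'a"
  assumes "is_adjoint T S"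
  shows "norm S \<le> norm T"
proof (rule norm_blinfun_bound)
  fix y
  have "(norm (S y))\<^sup>2 = T (S y) \<bullet> y"
    by (simp add: is_adjointD [OF assms] power2_norm_eq_inner)
  also have "\<dots> \<le> norm (T (S y)) * norm y"
    by (rule norm_cauchy_schwarz)
  also have "\<dots> \<le> (norm T * norm (S y)) * norm y"
    by (intro mult_right_mono norm_blinfun) auto
  finally have "norm (S y) * norm (S y) \<le> (norm T * norm y) * norm (S y)"
    by (simp add: power2_eq_square mult_ac)
  then show "norm (S y) \<le> norm T * norm y"
    by (cases "norm (S y) = 0") (auto simp: mult_le_cancel_right)
qed simp

section \<open>Operators that are bounded below\<close>

text \<open>Where \<open>T - scale_op z\<close> fails this, z is an approximate eigenvalue. For a
  self-adjoint \<open>T\<close> such points exhaust the real spectrum, and unlike invertibility the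
  property can be tested by norm estimates.\<close>

definition bounded_below :: "('a::real_normed_vector \<Rightarrow>\<^sub>L 'a) \<Rightarrow> bool"
  where "bounded_below T \<longleftrightarrow> (\<exists>c>0. \<forall>x. c * norm x \<le> norm (blinfun_apply T x))"

lemma bounded_below_compose:
  assumes "bounded_below S" "bounded_below T"
  shows "bounded_below (S o\<^sub>L T)"
proof -
  obtain c d where c: "c > 0" "\<And>x. c * norm x \<le> norm (S x)"
    and d: "d > 0" "\<And>x. d * norm x \<le> norm (T x)"
    using assms unfolding bounded_below_def by blast
  have "c * d * norm x \<le> norm ((S o\<^sub>L T) x)" for x
  proof -
    have "c * (d * norm x) \<le> c * norm (T x)"
      using c(1) d(2) by (intro mult_left_mono) auto
    with c(2) [of "T x"] show ?thesis by (simp add: mult.assoc)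
  qed
  with c(1) d(1) show ?thesis
    unfolding bounded_below_def by (meson mult_pos_pos)
qed

lemma not_bounded_below_in_spectrum:
  fixes T :: "'a::chilbert_space \<Rightarrow>\<^sub>L 'a"
  assumes "\<not> bounded_below (T - scale_op z)"
  shows "z \<in> spectrum T"
proof (rule ccontr)
  assume "z \<notin> spectrum T"
  then obtain S where S: "\<And>x. blinfun_apply S (T x - z *\<^sub>C x) = x"
    unfolding spectrum_def by blast
  \<comment> \<open>The added 1 keeps the denominator positive even if \<open>S\<close> is zero, as
    on the zero space.\<close>
  have "1 / (norm S + 1) * norm x \<le> norm ((T - scale_op z) x)" for x
  proof -
    have "norm x = norm (S ((T - scale_op z) x))"
      by (simp add: S blinfun.diff_left)
    also have "\<dots> \<le> norm S * norm ((T - scale_op z) x)"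
      by (rule norm_blinfun)
    also have "\<dots> \<le> (norm S + 1) * norm ((T - scale_op z) x)"
      by (intro mult_right_mono) auto
    finally show ?thesis
      by (simp add: pos_divide_le_eq add_nonneg_pos mult.commute)
  qed
  moreover have "1 / (norm S + 1) > 0"
    by (simp add: add_nonneg_pos)
  ultimately show False
    using assms unfolding bounded_below_def by blast
qed

text \<open>With \<open>K = \<parallel>A\<parallel> + 1\<close>, a fixed point of the contraction \<open>x \<mapsto> x - (A\<^sup>2 x - A y) / K\<^sup>2\<close> solves
  \<open>A x = y\<close>.\<close>

lemma bounded_below_surj:
  fixes A :: "'a::chilbert_space \<Rightarrow>\<^sub>L 'a"
  assumes "is_adjoint A A" "bounded_below A"
  shows "\<exists>x. blinfun_apply A x = y"
proof -
  obtain c0 where c0: "c0 > 0" "\<And>x. c0 * norm x \<le> norm (A x)"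
    using assms(2) unfolding bounded_below_def by blast
  define K where "K = norm A + 1"
  \<comment> \<open>Capping \<open>c0\<close> at \<open>K\<close> makes 1 - c^2/K^2, the squared
    contraction factor, non-negative.\<close>
  define c where "c = min c0 K"
  have K: "K > 0" "\<And>x. norm (A x) \<le> K * norm x"
  proof -
    show "K > 0" by (simp add: K_def add_nonneg_pos)
    show "norm (A x) \<le> K * norm x" for x
      using norm_blinfun [of A x] by (simp add: K_def algebra_simps add_increasing)
  qed
  have c: "c > 0" "c \<le> K" "c * norm x \<le> norm (A x)" for x
    using c0(1) K(1) c0(2) [of x] mult_right_mono [of c c0 "norm x"]
    by (auto simp: c_def)
  define F where "F x = x - (1 / K\<^sup>2) *\<^sub>R (A (A x) - A y)" for x
  define L where "L = 1 - c\<^sup>2 / K\<^sup>2"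
  have L: "0 \<le> L" "L < 1"
    using c(1,2) K(1) by (auto simp: L_def field_simps power_mono)
  have contr: "dist (F x) (F y) \<le> sqrt L * dist x y" for x y
  proof -
    define d where "d = x - y"
    have "F x - F y = d - (1 / K\<^sup>2) *\<^sub>R A (A d)"
      by (simp add: F_def d_def blinfun.diff_right algebra_simps)
    then have "(norm (F x - F y))\<^sup>2 =
        (norm d)\<^sup>2 - 2 / K\<^sup>2 * (d \<bullet> A (A d)) + (1 / K\<^sup>2)\<^sup>2 * (norm (A (A d)))\<^sup>2"
      by (simp only: power2_norm_eq_inner inner_diff_left inner_diff_right inner_scaleR_left
          inner_scaleR_right inner_commute [of "A (A d)" d])
        (simp add: power2_eq_square diff_divide_distrib)
    also have "d \<bullet> A (A d) = (norm (A d))\<^sup>2"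
      by (simp add: power2_norm_eq_inner is_adjointD [OF assms(1)])
    \<comment> \<open>Here ||A (A d)|| \<le> K ||A d|| makes the quadratic term cancel half of the
      cross term.\<close>
    also have "(norm d)\<^sup>2 - 2 / K\<^sup>2 * (norm (A d))\<^sup>2 + (1 / K\<^sup>2)\<^sup>2 * (norm (A (A d)))\<^sup>2 \<le> (norm d)\<^sup>2 - 2 / K\<^sup>2 * (norm (A d))\<^sup>2 + (1 / K\<^sup>2)\<^sup>2 * (K * norm (A d))\<^sup>2"
      by (intro add_left_mono mult_left_mono power_mono K) auto
    also have "\<dots> = (norm d)\<^sup>2 - 1 / K\<^sup>2 * (norm (A d))\<^sup>2"
      using K(1) by (simp add: field_simps power2_eq_square)
    also have "\<dots> \<le> (norm d)\<^sup>2 - 1 / K\<^sup>2 * (c * norm d)\<^sup>2"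
      using c by (intro diff_left_mono mult_left_mono power_mono) auto
    also have "\<dots> = (sqrt L * norm d)\<^sup>2"
      using L by (simp add: L_def power_mult_distrib algebra_simps)
    finally show ?thesis
      using L by (simp add: dist_norm d_def power2_le_iff_abs_le)
  qed
  have "\<exists>!x. F x = x"
    by (rule banach_fix_type [where c = "sqrt L"]) (use contr L in auto)
  then obtain x where x: "F x = x" by blast
  then have "A (A x - y) = 0"
    using K(1) by (simp add: F_def blinfun.diff_right)
  then have "norm (A x - y) = 0"
    using c(1) c(3) [of "A x - y"] by (simp add: mult_le_0_iff)
  then show ?thesis by auto
qed

text \<open>A self-adjoint shift that is bounded below is injective, and surjective by
  \<open>bounded_below_surj\<close>; the lower bound c makes its inverse bounded by 1/c. The other
  direction holds for every operator.\<close>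

lemma real_spectrum_iff_not_bounded_below:
  fixes T :: "'a::chilbert_space \<Rightarrow>\<^sub>L 'a"
  assumes "T \<in> selfadjoint_ops"
  shows "t \<in> real_spectrum T \<longleftrightarrow> \<not> bounded_below (T - scale_op (complex_of_real t))"
proof
  assume t: "t \<in> real_spectrum T"
  show "\<not> bounded_below (T - scale_op (complex_of_real t))"
  proof
    define A where "A = T - scale_op (complex_of_real t)"
    assume "bounded_below (T - scale_op (complex_of_real t))"
    then have bb: "bounded_below A" by (simp add: A_def)
    have A_eq: "A x = T x - complex_of_real t *\<^sub>C x" for x
      by (simp add: A_def blinfun.diff_left)
    have T: "T \<in> bounded_ops" "is_adjoint T T"
      using assms by (auto simp: selfadjoint_ops_def)
    have A_scaleC: "A (c *\<^sub>C x) = c *\<^sub>C A x" for c x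
      by (simp add: A_eq bounded_opsD [OF T(1)] scaleC_diff_right scaleC_scaleC mult.commute)
    then have "A \<in> bounded_ops" by (simp add: bounded_ops_def)
    then have adj: "is_adjoint A A"
      using is_adjointD [OF T(2)]
      by (simp add: is_adjoint_bounded_ops_iff A_eq inner_diff_left inner_diff_right scaleC_of_real)
    obtain c where c: "c > 0" "\<And>x. c * norm x \<le> norm (A x)"
      using bb unfolding bounded_below_def by blast
    define S where "S y = (SOME x. A x = y)" for y
    have AS: "A (S y) = y" for y
      using someI_ex [OF bounded_below_surj [OF adj bb]] by (simp add: S_def)
    have inj: "x = y" if "A x = A y" for x y
    proof -
      have "A (x - y) = 0" using that by (simp add: blinfun.diff_right)
      then have "norm (x - y) = 0" using c(1) c(2) [of "x - y"] by (simp add: mult_le_0_iff)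
      then show ?thesis by simp
    qed
    have SA: "S (A x) = x" for x
      using AS inj by blast
    have "bounded_linear S"
    proof (rule bounded_linear_intro [where K = "1 / c"])
      show "S (x + y) = S x + S y" for x y
        by (rule inj) (simp add: AS blinfun.add_right)
      show "S (r *\<^sub>R x) = r *\<^sub>R S x" for r x
        by (rule inj) (simp add: AS blinfun.scaleR_right)
      show "norm (S x) \<le> norm x * (1 / c)" for x
        using c(1) c(2) [of "S x"] by (simp add: AS field_simps)
    qed
    then have app: "blinfun_apply (Blinfun S) = S"
      by (rule bounded_linear_Blinfun_apply)
    have "S (k *\<^sub>C x) = k *\<^sub>C S x" for k x
      by (rule inj) (simp add: AS A_scaleC)
    then have "Blinfun S \<in> bounded_ops"
      by (simp add: bounded_ops_def app)
    then have "complex_of_real t \<notin> spectrum T"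
      using AS SA A_eq app unfolding spectrum_def by fastforce
    with t show False by (simp add: real_spectrum_def)
  qed
next
  assume "\<not> bounded_below (T - scale_op (complex_of_real t))"
  then show "t \<in> real_spectrum T"
    by (simp add: real_spectrum_def not_bounded_below_in_spectrum)
qed

text \<open>Moving the shift from t to s costs at most |s - t| in the lower bound, which makes the
  complement of the spectrum open.\<close>

lemma norm_shift_perturb:
  fixes T :: "'a::chilbert_space \<Rightarrow>\<^sub>L 'a"
  shows "norm ((T - scale_op (complex_of_real t)) x) - \<bar>s - t\<bar> * norm x
    \<le> norm ((T - scale_op (complex_of_real s)) x)"
proof -
  have "(T - scale_op (complex_of_real t)) x
      = (T - scale_op (complex_of_real s)) x + (s - t) *\<^sub>R x"
    by (simp add: blinfun.diff_left scaleC_of_real algebra_simps)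
  then show ?thesis
    using norm_triangle_ineq [of "(T - scale_op (complex_of_real s)) x" "(s - t) *\<^sub>R x"] by simp
qed

lemma real_spectrum_le_norm:
  fixes T :: "'a::chilbert_space \<Rightarrow>\<^sub>L 'a"
  assumes "T \<in> selfadjoint_ops" "t \<in> real_spectrum T"
  shows "\<bar>t\<bar> \<le> norm T"
proof (rule ccontr)
  assume "\<not> \<bar>t\<bar> \<le> norm T"
  moreover have "(\<bar>t\<bar> - norm T) * norm x \<le> norm ((T - scale_op (complex_of_real t)) x)" for x
  proof -
    have "(T - scale_op (complex_of_real t)) x = T x - t *\<^sub>R x"
      by (simp add: blinfun.diff_left scaleC_of_real)
    then show ?thesis
      using norm_blinfun [of T x] norm_triangle_ineq2 [of "t *\<^sub>R x" "T x"]
      by (simp add: left_diff_distrib norm_minus_commute [of "T x"])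
  qed
  ultimately have "bounded_below (T - scale_op (complex_of_real t))"
    unfolding bounded_below_def by (intro exI [of _ "\<bar>t\<bar> - norm T"]) auto
  with assms show False by (simp add: real_spectrum_iff_not_bounded_below)
qed

lemma compact_real_spectrum:
  fixes T :: "'a::chilbert_space \<Rightarrow>\<^sub>L 'a"
  assumes "T \<in> selfadjoint_ops"
  shows "compact (real_spectrum T)"
proof -
  have "open (- real_spectrum T)"
    unfolding open_dist
  proof safe
    fix t assume "t \<notin> real_spectrum T"
    then obtain c where c: "c > 0" "\<And>x. c * norm x \<le> norm ((T - scale_op (complex_of_real t)) x)"
      using assms by (auto simp: real_spectrum_iff_not_bounded_below bounded_below_def)
    have "s \<notin> real_spectrum T" if s: "dist s t < c / 2" for s
    proof -
      have "c / 2 * norm x \<le> norm ((T - scale_op (complex_of_real s)) x)" for x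
      proof -
        have "\<bar>s - t\<bar> * norm x \<le> c / 2 * norm x"
          using s by (intro mult_right_mono) (auto simp: dist_real_def)
        then show ?thesis
          using norm_shift_perturb [of T t x s] c(2) [of x] by (simp add: algebra_simps)
      qed
      then have "bounded_below (T - scale_op (complex_of_real s))"
        unfolding bounded_below_def using c(1) by (intro exI [of _ "c / 2"]) auto
      then show ?thesis using assms by (simp add: real_spectrum_iff_not_bounded_below)
    qed
    then show "\<exists>e>0. \<forall>s. dist s t < e \<longrightarrow> s \<in> - real_spectrum T"
      using c(1) by (intro exI [of _ "c / 2"]) auto
  qed
  then have "closed (real_spectrum T)" by (simp add: closed_def)
  moreover have "bounded (real_spectrum T)"
    using real_spectrum_le_norm [OF assms] by (auto simp: bounded_iff)
  ultimately show ?thesis by (simp add: compact_eq_bounded_closed)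
qed

section \<open>Polynomials in an operator\<close>

text \<open>Horner's scheme, so that the equation on \<open>pCons\<close> matches induction over
  polynomials.\<close>

definition op_poly :: "('a::chilbert_space \<Rightarrow>\<^sub>L 'a) \<Rightarrow> complex poly \<Rightarrow> ('a \<Rightarrow>\<^sub>L 'a)"
  where "op_poly T p = fold_coeffs (\<lambda>a S. scale_op a + (T o\<^sub>L S)) p 0"

lemma scale_op_0 [simp]: "scale_op 0 = 0"
  by (rule blinfun_eqI) simp

lemma scale_op_1: "scale_op 1 = id_blinfun"
  by (rule blinfun_eqI) simp

lemma op_poly_0 [simp]: "op_poly T 0 = 0"
  by (simp add: op_poly_def)

lemma op_poly_pCons [simp]: "op_poly T (pCons a p) = scale_op a + (T o\<^sub>L op_poly T p)"
  by (cases "a = 0 \<and> p = 0") (auto simp: op_poly_def)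

lemma op_poly_bounded_ops [simp]: "T \<in> bounded_ops \<Longrightarrow> op_poly T p \<in> bounded_ops"
  by (induction p) (auto simp: bounded_ops_def blinfun.add_left scaleC_add_right scaleC_scaleC mult.commute)

lemma op_poly_add: "op_poly T (p + q) = op_poly T p + op_poly T q"
  by (induction p q rule: poly_induct2)
    (auto intro!: blinfun_eqI simp: blinfun.add_left blinfun.add_right scaleC_add_left)

lemma op_poly_smult:
  "T \<in> bounded_ops \<Longrightarrow> op_poly T (smult c p) = scale_op c o\<^sub>L op_poly T p"
  by (induction p)
    (auto intro!: blinfun_eqI simp: blinfun.add_left scaleC_add_right scaleC_scaleC bounded_opsD)

lemma op_poly_diff: "op_poly T (p - q) = op_poly T p - op_poly T q"
  using op_poly_add [of T "p - q" q] by simp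

lemma op_poly_mult:
  "T \<in> bounded_ops \<Longrightarrow> op_poly T (p * q) = op_poly T p o\<^sub>L op_poly T q"
  by (induction p)
    (auto intro!: blinfun_eqI simp: mult_pCons_left op_poly_add op_poly_smult blinfun.add_left)

lemma op_poly_X: "op_poly T [:0, 1:] = T"
  by (rule blinfun_eqI) (simp add: blinfun.add_left)

lemma op_poly_commute:
  "T \<in> bounded_ops \<Longrightarrow> op_poly T p o\<^sub>L T = T o\<^sub>L op_poly T p"
  using op_poly_mult [of T p "[:0, 1:]"] op_poly_mult [of T "[:0, 1:]" p]
  by (simp only: op_poly_X mult.commute [of p])

lemma op_poly_adjoint:
  assumes "T \<in> selfadjoint_ops"
  shows "is_adjoint (op_poly T p) (op_poly T (map_poly cnj p))"
proof (induction p)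
  case 0
  show ?case by (simp add: is_adjoint_def cinner_eq_Complex)
next
  case (pCons a p)
  have T: "T \<in> bounded_ops" "is_adjoint T T"
    using assms by (auto simp: selfadjoint_ops_def)
  \<comment> \<open>Taking adjoints reverses the order of \<open>T\<close> and the polynomial;
    commutation restores it.\<close>
  have comm: "T (op_poly T q x) = op_poly T q (T x)" for q x
    using op_poly_commute [OF T(1), of q] by (metis blinfun_apply_blinfun_compose)
  have *: "cinner (x + y) z = cinner x z + cinner y z" for x y z :: 'a
    by (metis cinner_add_right cinner_commute complex_cnj_add)
  show ?case
    using pCons T(2) unfolding is_adjoint_def
    by (simp add: map_poly_pCons blinfun.add_left * cinner_add_right cinner_scaleC_left
        cinner_scaleC_right comm)
qed

text \<open>Split off linear factors with the fundamental theorem of algebra: if a composition is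
  not bounded below, then one of its factors is not.\<close>

lemma op_poly_not_bounded_below:
  assumes Tb: "T \<in> bounded_ops" and "q \<noteq> 0" "\<not> bounded_below (op_poly T q)"
  shows "\<exists>z. poly q z = 0 \<and> \<not> bounded_below (T - scale_op z)"
  using assms(2,3)
proof (induction "degree q" arbitrary: q)
  case 0
  then obtain a where q: "q = [:a:]" by (metis degree_eq_zeroE)
  with 0 have "a \<noteq> 0" by simp
  then have "bounded_below (op_poly T q)"
    unfolding bounded_below_def
    by (intro exI [of _ "cmod a"]) (simp add: q blinfun.add_left norm_scaleC)
  with 0 show ?case by simp
next
  case (Suc n)
  have "\<not> constant (poly q)"
    using Suc.hyps(2) by (simp add: constant_degree)
  then obtain z where z: "poly q z = 0"
    using fundamental_theorem_of_algebra by blast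
  then obtain r where r: "q = [:- z, 1:] * r"
    by (metis poly_eq_0_iff_dvd dvdE)
  with Suc.prems have "r \<noteq> 0" by auto
  then have "degree q = Suc (degree r)"
    unfolding r by (subst degree_mult_eq) auto
  with Suc.hyps have deg: "n = degree r" by simp
  have "op_poly T q = (T - scale_op z) o\<^sub>L op_poly T r"
    unfolding r op_poly_mult [OF Tb]
    by (rule blinfun_eqI) (simp add: blinfun.add_left blinfun.diff_left scaleC_minus_left)
  then consider "\<not> bounded_below (T - scale_op z)" | "\<not> bounded_below (op_poly T r)"
    using Suc.prems bounded_below_compose by metis
  then show ?case
  proof cases
    case 1
    with z show ?thesis by blast
  next
    case 2
    with Suc.hyps(1) [OF deg \<open>r \<noteq> 0\<close>] show ?thesis by (auto simp: r)
  qed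
qed

text \<open>Since <x, T x> is real, the imaginary part of <x, (T - z) x> is - Im z ||x||^2, and
  Cauchy-Schwarz bounds it by ||x|| ||(T - z) x||.\<close>

lemma nonreal_bounded_below:
  fixes T :: "'a::chilbert_space \<Rightarrow>\<^sub>L 'a"
  assumes "T \<in> selfadjoint_ops" "Im z \<noteq> 0"
  shows "bounded_below (T - scale_op z)"
proof -
  have adj: "is_adjoint T T"
    using assms(1) by (simp add: selfadjoint_ops_def)
  have "\<bar>Im z\<bar> * norm x \<le> norm ((T - scale_op z) x)" for x
  proof -
    define w where "w = (T - scale_op z) x"
    have "Im (cinner x (T x)) = 0"
      using adj unfolding is_adjoint_def
      by (metis cinner_commute complex_cnj_cancel_iff cnj.simps(2) equal_neg_zero)
    then have "Im (cinner x w) = - Im z * (norm x)\<^sup>2"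
      using cinner_add_right [of x w "z *\<^sub>C x"]
      by (simp add: w_def blinfun.diff_left cinner_scaleC_right cinner_self complex_eq_iff)
    moreover have "\<bar>Im (cinner x w)\<bar> \<le> norm x * norm w"
      using Cauchy_Schwarz_ineq2 [of x "(- \<i>) *\<^sub>C w"]
      by (simp add: cinner_eq_Complex norm_scaleC)
    ultimately have "norm x * (\<bar>Im z\<bar> * norm x) \<le> norm x * norm w"
      by (simp add: abs_mult power2_eq_square mult_ac)
    then show ?thesis
      by (cases "norm x = 0") (auto simp: w_def)
  qed
  with assms(2) show ?thesis
    unfolding bounded_below_def by (intro exI [of _ "\<bar>Im z\<bar>"]) auto
qed

lemma real_root_in_spectrum:
  fixes T :: "'a::chilbert_space \<Rightarrow>\<^sub>L 'a"
  assumes "T \<in> selfadjoint_ops" "q \<noteq> 0" "\<not> bounded_below (op_poly T q)"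
  shows "\<exists>t\<in>real_spectrum T. poly q (complex_of_real t) = 0"
proof -
  obtain z where z: "poly q z = 0" "\<not> bounded_below (T - scale_op z)"
    using op_poly_not_bounded_below [OF _ assms(2,3)] assms(1) by (auto simp: selfadjoint_ops_def)
  then have "z = complex_of_real (Re z)"
    using nonreal_bounded_below [OF assms(1), of z] by (auto simp: complex_eq_iff)
  then show ?thesis
    using z by (metis real_spectrum_iff_not_bounded_below [OF assms(1)])
qed

text \<open>Approximate maximisers of \<open>\<parallel>P x\<parallel>\<close> are approximate eigenvectors of \<open>P\<^sup>* P\<close> for \<open>\<parallel>P\<parallel>\<^sup>2\<close>.\<close>

lemma adjoint_compose_not_bounded_below:
  fixes P Q :: "'a::chilbert_space \<Rightarrow>\<^sub>L 'a"
  assumes adj: "is_adjoint P Q" and "P \<noteq> 0"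
  shows "\<not> bounded_below ((Q o\<^sub>L P) - scale_op (complex_of_real ((norm P)\<^sup>2)))"
proof
  define l where "l = (norm P)\<^sup>2"
  assume "bounded_below ((Q o\<^sub>L P) - scale_op (complex_of_real ((norm P)\<^sup>2)))"
  then obtain c where c: "c > 0"
      "\<And>x. c * norm x \<le> norm (((Q o\<^sub>L P) - scale_op (complex_of_real l)) x)"
    unfolding bounded_below_def l_def by blast
  have l: "l > 0" using assms(2) by (simp add: l_def)
  \<comment> \<open>Expanding ||(Q P - l) x||^2 with ||Q|| \<le> ||P|| turns the assumed lower bound
    into a bound for \<open>P\<close> strictly below its norm.\<close>
  have bound: "(norm (P x))\<^sup>2 \<le> (l - c\<^sup>2 / l) * (norm x)\<^sup>2" for x
  proof -
    have "(c * norm x)\<^sup>2 \<le> (norm (Q (P x) - l *\<^sub>R x))\<^sup>2"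
      using c(1) c(2) [of x] by (intro power_mono) (auto simp: blinfun.diff_left scaleC_of_real)
    also have "\<dots> = (norm (Q (P x)))\<^sup>2 - 2 * l * (x \<bullet> Q (P x)) + l\<^sup>2 * (norm x)\<^sup>2"
      unfolding power2_norm_eq_inner inner_diff_left inner_diff_right inner_scaleR_left
          inner_scaleR_right inner_commute [of "Q (P x)" x]
      by (simp add: power2_eq_square algebra_simps)
    also have "x \<bullet> Q (P x) = (norm (P x))\<^sup>2"
      by (simp add: power2_norm_eq_inner flip: is_adjointD [OF adj])
    also have "(norm (Q (P x)))\<^sup>2 \<le> (norm P * norm (P x))\<^sup>2"
      using norm_blinfun [of Q "P x"] norm_adjoint_le [OF adj]
      by (intro power_mono) (auto intro: order_trans [OF _ mult_right_mono])
    also have "(norm P * norm (P x))\<^sup>2 = l * (norm (P x))\<^sup>2"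
      by (simp add: l_def power_mult_distrib)
    finally have "c\<^sup>2 * (norm x)\<^sup>2 + l * (norm (P x))\<^sup>2 \<le> l\<^sup>2 * (norm x)\<^sup>2"
      by (simp add: power_mult_distrib algebra_simps)
    then have "(norm (P x))\<^sup>2 \<le> (l\<^sup>2 * (norm x)\<^sup>2 - c\<^sup>2 * (norm x)\<^sup>2) / l"
      using l by (simp add: pos_le_divide_eq algebra_simps)
    also have "\<dots> = (l - c\<^sup>2 / l) * (norm x)\<^sup>2"
      using l by (simp add: diff_divide_distrib left_diff_distrib power2_eq_square)
    finally show ?thesis .
  qed
  define m where "m = l - c\<^sup>2 / l"
  have m: "m < l" using c(1) l by (simp add: m_def)
  \<comment> \<open>\<open>m\<close> could be negative, so the square root is taken of its positive
    part.\<close>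
  have "norm (P x) \<le> sqrt (max m 0) * norm x" for x
  proof (rule power2_le_imp_le)
    have "(norm (P x))\<^sup>2 \<le> m * (norm x)\<^sup>2" using bound by (simp add: m_def)
    also have "\<dots> \<le> max m 0 * (norm x)\<^sup>2" by (intro mult_right_mono) auto
    finally show "(norm (P x))\<^sup>2 \<le> (sqrt (max m 0) * norm x)\<^sup>2"
      by (simp add: power_mult_distrib)
  qed simp
  then have "norm P \<le> sqrt (max m 0)"
    by (intro norm_blinfun_bound) auto
  then have "l \<le> max m 0"
    unfolding l_def by (metis max.cobounded2 norm_ge_zero power_mono real_sqrt_pow2)
  with m l show False by simp
qed

lemma op_poly_norm_le:
  fixes T :: "'a::chilbert_space \<Rightarrow>\<^sub>L 'a"
  assumes T: "T \<in> selfadjoint_ops"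
    and le: "\<And>t. t \<in> real_spectrum T \<Longrightarrow> cmod (poly p (complex_of_real t)) \<le> e" and "0 \<le> e"
  shows "norm (op_poly T p) \<le> e"
proof (cases "op_poly T p = 0")
  case False
  have Tb: "T \<in> bounded_ops" using T by (simp add: selfadjoint_ops_def)
  \<comment> \<open>On real points |r|^2 is the polynomial \<open>map_poly cnj r * r\<close>, so a
    spectral root of the shifted polynomial is a point where |r| equals ||r(T)||.\<close>
  have key: "\<exists>t\<in>real_spectrum T. cmod (poly r (complex_of_real t)) = norm (op_poly T r)"
    if nz: "op_poly T r \<noteq> 0" and nc: "map_poly cnj r * r - [:complex_of_real ((norm (op_poly T r))\<^sup>2):] \<noteq> 0" for r
  proof -
    define l where "l = complex_of_real ((norm (op_poly T r))\<^sup>2)"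
    have "op_poly T (map_poly cnj r * r - [:l:]) = (op_poly T (map_poly cnj r) o\<^sub>L op_poly T r) - scale_op l"
      by (simp add: op_poly_diff op_poly_mult [OF Tb])
    then have "\<not> bounded_below (op_poly T (map_poly cnj r * r - [:l:]))"
      using adjoint_compose_not_bounded_below [OF op_poly_adjoint [OF T] nz] by (simp add: l_def)
    then obtain t where t: "t \<in> real_spectrum T" "poly (map_poly cnj r * r - [:l:]) (complex_of_real t) = 0"
      using real_root_in_spectrum [OF T] nc unfolding l_def by blast
    have "poly (map_poly cnj r) (complex_of_real t) = cnj (poly r (complex_of_real t))"
      using poly_cnj [of r "complex_of_real t"] by simp
    then have "complex_of_real ((cmod (poly r (complex_of_real t)))\<^sup>2) = l"
      using t(2) complex_norm_square [of "poly r (complex_of_real t)"] by (simp add: mult.commute)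
    then have "(cmod (poly r (complex_of_real t)))\<^sup>2 = (norm (op_poly T r))\<^sup>2"
      unfolding l_def of_real_eq_iff .
    then show ?thesis
      using t(1) by (auto simp: power2_eq_iff_nonneg)
  qed
  show ?thesis
  proof (cases "map_poly cnj p * p - [:complex_of_real ((norm (op_poly T p))\<^sup>2):] = 0")
    case False
    with key [OF \<open>op_poly T p \<noteq> 0\<close>] le show ?thesis by metis
  next
    case True
    \<comment> \<open>If |p|^2 is the constant ||p(T)||^2, any spectral point will do; what remains
      is that the spectrum is nonempty. For \<open>T\<close> = 0 the point 0 is in it, otherwise
      \<open>key\<close> applies to the polynomial X.\<close>
    have "\<exists>t. t \<in> real_spectrum T"
    proof (cases "T = 0")
      case True
      obtain x where "op_poly T p x \<noteq> 0"
        using \<open>op_poly T p \<noteq> 0\<close> by (metis blinfun_eqI zero_blinfun.rep_eq)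
      then have "\<not> bounded_below (T - scale_op (complex_of_real 0))"
        using True by (auto simp: bounded_below_def mult_le_0_iff not_less)
      then show ?thesis
        using real_spectrum_iff_not_bounded_below [OF T] by blast
    next
      case False
      then show ?thesis
        using key [of "[:0, 1:]"] by (auto simp: op_poly_X map_poly_pCons simp del: op_poly_pCons)
    qed
    then obtain t where t: "t \<in> real_spectrum T" by blast
    have "poly (map_poly cnj p * p) (complex_of_real t) = complex_of_real ((norm (op_poly T p))\<^sup>2)"
      using True by (simp del: poly_mult)
    moreover have "poly (map_poly cnj p) (complex_of_real t) = cnj (poly p (complex_of_real t))"
      using poly_cnj [of p "complex_of_real t"] by simp
    ultimately have "complex_of_real ((cmod (poly p (complex_of_real t)))\<^sup>2)
        = complex_of_real ((norm (op_poly T p))\<^sup>2)"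
      using complex_norm_square [of "poly p (complex_of_real t)"] by (simp add: mult.commute)
    then have "(cmod (poly p (complex_of_real t)))\<^sup>2 = (norm (op_poly T p))\<^sup>2"
      unfolding of_real_eq_iff .
    then show ?thesis
      using le [OF t] by (auto simp: power2_eq_iff_nonneg)
  qed
qed (use \<open>0 \<le> e\<close> in simp)

section \<open>The continuous functional calculus\<close>

lemma complex_polynomial_approximation:
  fixes g :: "real \<Rightarrow> complex"
  assumes "compact K" "continuous_on K g" "0 < e"
  shows "\<exists>p. \<forall>t\<in>K. cmod (poly p (complex_of_real t) - g t) < e"
proof -
  have real: "\<exists>p. \<forall>t\<in>K. cmod (poly p (complex_of_real t) - complex_of_real (h t)) < e / 2"
    if h: "continuous_on K h" for h :: "real \<Rightarrow> real"
  proof -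
    obtain f where f: "real_polynomial_function f" "\<And>t. t \<in> K \<Longrightarrow> \<bar>h t - f t\<bar> < e / 2"
      using Stone_Weierstrass_real_polynomial_function [OF assms(1) h, of "e / 2"] assms(3) by auto
    obtain a n where "f = (\<lambda>x. \<Sum>i\<le>n. a i * x ^ i)"
      using f(1) unfolding real_polynomial_function_iff_sum by blast
    then have "poly (\<Sum>i\<le>n. monom (complex_of_real (a i)) i) (complex_of_real t) = complex_of_real (f t)" for t
      by (simp add: poly_sum poly_monom)
    then have "\<forall>t\<in>K. cmod (poly (\<Sum>i\<le>n. monom (complex_of_real (a i)) i) (complex_of_real t)
        - complex_of_real (h t)) < e / 2"
      using f(2) by (auto simp: abs_minus_commute simp flip: of_real_diff)
    then show ?thesis by blast
  qed
  obtain p where p: "\<forall>t\<in>K. cmod (poly p (complex_of_real t) - complex_of_real (Re (g t))) < e / 2"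
    using real [of "\<lambda>t. Re (g t)"] continuous_on_Re [OF assms(2)] by blast
  obtain q where q: "\<forall>t\<in>K. cmod (poly q (complex_of_real t) - complex_of_real (Im (g t))) < e / 2"
    using real [of "\<lambda>t. Im (g t)"] continuous_on_Im [OF assms(2)] by blast
  have "cmod (poly (p + smult \<i> q) (complex_of_real t) - g t) < e" if "t \<in> K" for t
  proof -
    have "poly (p + smult \<i> q) (complex_of_real t) - g t
        = (poly p (complex_of_real t) - complex_of_real (Re (g t)))
          + \<i> * (poly q (complex_of_real t) - complex_of_real (Im (g t)))"
      by (subst complex_eq [of "g t"]) (simp add: algebra_simps)
    also have "cmod \<dots> \<le> cmod (poly p (complex_of_real t) - complex_of_real (Re (g t)))
          + cmod (poly q (complex_of_real t) - complex_of_real (Im (g t)))"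
      by (rule order_trans [OF norm_triangle_ineq]) (simp add: norm_mult)
    also have "\<dots> < e" using p q that by force
    finally show ?thesis .
  qed
  then show ?thesis by blast
qed

text \<open>A relation between functions and operators: for self-adjoint \<open>T\<close> it is
  single-valued and total on continuous functions by \<open>cfc_limit_unique\<close> and
  \<open>cfc_limit_exists\<close>, and the algebraic laws pass to it from polynomials by
  limits.\<close>

definition cfc_limit ::
    "('a::chilbert_space \<Rightarrow>\<^sub>L 'a) \<Rightarrow> (real \<Rightarrow> complex) \<Rightarrow> ('a \<Rightarrow>\<^sub>L 'a) \<Rightarrow> bool"
  where "cfc_limit T g S \<longleftrightarrow>
    (\<exists>p. uniform_limit (real_spectrum T) (\<lambda>n t. poly (p n) (complex_of_real t)) g sequentially
      \<and> (\<lambda>n. op_poly T (p n)) \<longlonglongrightarrow> S)"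

lemma cfc_limit_cong:
  assumes "cfc_limit T g S" "\<And>t. t \<in> real_spectrum T \<Longrightarrow> g t = h t"
  shows "cfc_limit T h S"
proof -
  have "uniform_limit (real_spectrum T) F g sequentially
      \<longleftrightarrow> uniform_limit (real_spectrum T) F h sequentially" for F :: "nat \<Rightarrow> real \<Rightarrow> complex"
    using assms(2) by (intro uniform_limit_cong') auto
  with assms(1) show ?thesis unfolding cfc_limit_def by simp
qed

lemma cfc_limit_poly: "cfc_limit T (\<lambda>t. poly p (complex_of_real t)) (op_poly T p)"
  unfolding cfc_limit_def by (intro exI [of _ "\<lambda>_. p"]) (simp add: uniform_limit_const)

lemma cfc_limit_add:
  assumes "cfc_limit T g S" "cfc_limit T h R"
  shows "cfc_limit T (\<lambda>t. g t + h t) (S + R)"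
proof -
  obtain p q where
    p: "uniform_limit (real_spectrum T) (\<lambda>n t. poly (p n) (complex_of_real t)) g sequentially"
      "(\<lambda>n. op_poly T (p n)) \<longlonglongrightarrow> S" and
    q: "uniform_limit (real_spectrum T) (\<lambda>n t. poly (q n) (complex_of_real t)) h sequentially"
      "(\<lambda>n. op_poly T (q n)) \<longlonglongrightarrow> R"
    using assms unfolding cfc_limit_def by blast
  show ?thesis unfolding cfc_limit_def
    using uniform_limit_add [OF p(1) q(1)] tendsto_add [OF p(2) q(2)]
    by (intro exI [of _ "\<lambda>n. p n + q n"]) (simp add: op_poly_add)
qed

lemma cfc_limit_mult:
  assumes "T \<in> selfadjoint_ops" "cfc_limit T g S" "cfc_limit T h R"
    "continuous_on (real_spectrum T) g" "continuous_on (real_spectrum T) h"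
  shows "cfc_limit T (\<lambda>t. g t * h t) (S o\<^sub>L R)"
proof -
  obtain p q where
    p: "uniform_limit (real_spectrum T) (\<lambda>n t. poly (p n) (complex_of_real t)) g sequentially"
      "(\<lambda>n. op_poly T (p n)) \<longlonglongrightarrow> S" and
    q: "uniform_limit (real_spectrum T) (\<lambda>n t. poly (q n) (complex_of_real t)) h sequentially"
      "(\<lambda>n. op_poly T (q n)) \<longlonglongrightarrow> R"
    using assms(2,3) unfolding cfc_limit_def by blast
  have T: "T \<in> bounded_ops" using assms(1) by (simp add: selfadjoint_ops_def)
  \<comment> \<open>Uniform convergence of products needs bounded limits, supplied by compactness of
    the spectrum.\<close>
  have bdd: "bounded (k ` real_spectrum T)" if "continuous_on (real_spectrum T) k" for k :: "real \<Rightarrow> complex"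
    using compact_continuous_image [OF that compact_real_spectrum [OF assms(1)]]
    by (rule compact_imp_bounded)
  have "uniform_limit (real_spectrum T)
      (\<lambda>n t. poly (p n) (complex_of_real t) * poly (q n) (complex_of_real t)) (\<lambda>t. g t * h t) sequentially"
    by (intro uniform_lim_mult p q bdd assms)
  moreover have "(\<lambda>n. op_poly T (p n) o\<^sub>L op_poly T (q n)) \<longlonglongrightarrow> (S o\<^sub>L R)"
    by (intro bounded_bilinear.tendsto [OF bounded_bilinear_blinfun_compose] p q)
  ultimately show ?thesis unfolding cfc_limit_def
    by (intro exI [of _ "\<lambda>n. p n * q n"]) (simp add: op_poly_mult [OF T])
qed

lemma is_adjoint_limit:
  assumes "\<And>n. is_adjoint (A n) (B n)" "A \<longlonglongrightarrow> S" "B \<longlonglongrightarrow> R"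
    "\<And>n. B n \<in> bounded_ops"
  shows "R \<in> bounded_ops" "is_adjoint S R"
proof -
  have A: "(\<lambda>n. A n x) \<longlonglongrightarrow> S x" and B: "(\<lambda>n. B n x) \<longlonglongrightarrow> R x" for x
    using assms(2,3) by (auto intro: tendsto_intros)
  have "R (c *\<^sub>C x) = c *\<^sub>C R x" for c x
  proof (rule LIMSEQ_unique)
    show "(\<lambda>n. B n (c *\<^sub>C x)) \<longlonglongrightarrow> R (c *\<^sub>C x)" by (rule B)
    have "(\<lambda>n. scale_op c (B n x)) \<longlonglongrightarrow> scale_op c (R x)"
      by (intro tendsto_intros B)
    then show "(\<lambda>n. B n (c *\<^sub>C x)) \<longlonglongrightarrow> c *\<^sub>C R x"
      using assms(4) by (simp add: bounded_opsD)
  qed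
  then show R: "R \<in> bounded_ops" by (simp add: bounded_ops_def)
  show "is_adjoint S R"
    unfolding is_adjoint_bounded_ops_iff [OF R]
  proof safe
    fix x y
    show "S x \<bullet> y = x \<bullet> R y"
    proof (rule LIMSEQ_unique)
      show "(\<lambda>n. A n x \<bullet> y) \<longlonglongrightarrow> S x \<bullet> y" by (intro tendsto_intros A)
      show "(\<lambda>n. A n x \<bullet> y) \<longlonglongrightarrow> x \<bullet> R y"
        unfolding is_adjointD [OF assms(1)] by (intro tendsto_intros B)
    qed
  qed
qed

lemma cfc_limit_norm_le:
  assumes "T \<in> selfadjoint_ops" "cfc_limit T g S"
    "\<And>t. t \<in> real_spectrum T \<Longrightarrow> cmod (g t) \<le> e" "0 \<le> e"
  shows "norm S \<le> e"
proof (rule field_le_epsilon)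
  fix d :: real assume d: "0 < d"
  obtain p where
    p: "uniform_limit (real_spectrum T) (\<lambda>n t. poly (p n) (complex_of_real t)) g sequentially"
      "(\<lambda>n. op_poly T (p n)) \<longlonglongrightarrow> S"
    using assms(2) unfolding cfc_limit_def by blast
  have "\<forall>\<^sub>F n in sequentially. norm (op_poly T (p n)) \<le> e + d"
    using uniform_limitD [OF p(1) d]
  proof eventually_elim
    case (elim n)
    show ?case
    proof (rule op_poly_norm_le [OF assms(1)])
      fix t assume t: "t \<in> real_spectrum T"
      have "dist (poly (p n) (complex_of_real t)) (g t) < d" using elim t by blast
      then show "cmod (poly (p n) (complex_of_real t)) \<le> e + d"
        using assms(3) [OF t] norm_triangle_ineq2 [of "poly (p n) (complex_of_real t)" "g t"]
        by (simp add: dist_norm)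
    qed (use assms(4) d in simp)
  qed
  then show "norm S \<le> e + d"
    by (rule tendsto_upperbound [OF tendsto_norm [OF p(2)]]) simp
qed

text \<open>S - R is a limit for the zero function, and the norm estimate forces it to vanish.
  Subtraction is expressed through the constant polynomial -1, so that the laws for sums and
  products suffice.\<close>

lemma cfc_limit_unique:
  assumes T: "T \<in> selfadjoint_ops" and "cfc_limit T g S" "cfc_limit T g R"
    "continuous_on (real_spectrum T) g"
  shows "S = R"
proof -
  have "cfc_limit T (\<lambda>t. g t + poly [:- 1:] (complex_of_real t) * g t) (S + (op_poly T [:- 1:] o\<^sub>L R))"
    by (intro cfc_limit_add cfc_limit_mult cfc_limit_poly assms continuous_intros)
  then have "norm (S + (op_poly T [:- 1:] o\<^sub>L R)) \<le> 0"
    by (rule cfc_limit_norm_le [OF T]) auto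
  then have "S + (op_poly T [:- 1:] o\<^sub>L R) = 0" by simp
  then have "(S + (op_poly T [:- 1:] o\<^sub>L R)) x = 0" for x by simp
  then have "S x - R x = 0" for x
    by (simp add: blinfun.add_left scaleC_minus_left)
  then show ?thesis by (intro blinfun_eqI) simp
qed

text \<open>Polynomials within 1/(n+1) of g are uniformly Cauchy on the spectrum, hence Cauchy in
  operator norm by \<open>op_poly_norm_le\<close>, and completeness gives the limit.\<close>

lemma cfc_limit_exists:
  assumes T: "T \<in> selfadjoint_ops" and g: "continuous_on (real_spectrum T) g"
  shows "\<exists>S. cfc_limit T g S"
proof -
  have "\<exists>p. \<forall>n. \<forall>t\<in>real_spectrum T.
      cmod (poly (p n) (complex_of_real t) - g t) < inverse (real (Suc n))"
    by (intro choice allI complex_polynomial_approximation compact_real_spectrum T g) simp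
  then obtain p where p: "\<And>n t. t \<in> real_spectrum T \<Longrightarrow>
      cmod (poly (p n) (complex_of_real t) - g t) < inverse (real (Suc n))"
    by blast
  have inv_mono: "inverse (real (Suc n)) \<le> inverse (real (Suc N))" if "N \<le> n" for n N
    using that by (intro le_imp_inverse_le) auto
  have "uniform_limit (real_spectrum T) (\<lambda>n t. poly (p n) (complex_of_real t)) g sequentially"
  proof (rule uniform_limitI)
    fix e :: real assume "0 < e"
    then obtain N where N: "inverse (real (Suc N)) < e" using reals_Archimedean by blast
    have "inverse (real (Suc n)) < e" if "n \<ge> N" for n
      using inv_mono [OF that] N by linarith
    then show "\<forall>\<^sub>F n in sequentially. \<forall>t\<in>real_spectrum T. dist (poly (p n) (complex_of_real t)) (g t) < e"
      unfolding eventually_sequentially dist_norm using p by (meson less_trans)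
  qed
  moreover have "Cauchy (\<lambda>n. op_poly T (p n))"
  proof (rule metric_CauchyI)
    fix e :: real assume "0 < e"
    then obtain N where N: "inverse (real (Suc N)) < e / 3"
      using reals_Archimedean [of "e / 3"] by auto
    have *: "inverse (real (Suc n)) < e / 3" if "n \<ge> N" for n
      using inv_mono [OF that] N by linarith
    have "dist (op_poly T (p m)) (op_poly T (p n)) < e" if mn: "m \<ge> N" "n \<ge> N" for m n
    proof -
      have "norm (op_poly T (p m - p n)) \<le> 2 * e / 3"
      proof (rule op_poly_norm_le [OF T])
        fix t assume t: "t \<in> real_spectrum T"
        show "cmod (poly (p m - p n) (complex_of_real t)) \<le> 2 * e / 3"
          using p [OF t, of m] p [OF t, of n] * [OF mn(1)] * [OF mn(2)]
            norm_triangle_ineq4 [of "poly (p m) (complex_of_real t) - g t" "poly (p n) (complex_of_real t) - g t"]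
          by simp
      qed (use \<open>0 < e\<close> in simp)
      then show ?thesis using \<open>0 < e\<close> by (simp add: dist_norm op_poly_diff)
    qed
    then show "\<exists>M. \<forall>m\<ge>M. \<forall>n\<ge>M. dist (op_poly T (p m)) (op_poly T (p n)) < e" by blast
  qed
  ultimately show ?thesis
    unfolding cfc_limit_def by (meson Cauchy_convergent_iff convergent_def)
qed

lemma is_cfc_exists:
  fixes T :: "'a::chilbert_space \<Rightarrow>\<^sub>L 'a"
  assumes T: "T \<in> selfadjoint_ops"
  shows "\<exists>\<Phi>. is_cfc T \<Phi>"
proof -
  define \<Phi> where "\<Phi> g = (SOME S. cfc_limit T g S)" for g
  define C :: "(real \<Rightarrow> complex) set" where "C = {g. continuous_on (real_spectrum T) g}"
  have lim: "cfc_limit T g (\<Phi> g)" if "g \<in> C" for g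
    using someI_ex [OF cfc_limit_exists [OF T]] that by (simp add: \<Phi>_def C_def)
  have uniq: "\<Phi> g = S" if "g \<in> C" "cfc_limit T g S" for g S
    using cfc_limit_unique [OF T lim [OF that(1)] that(2)] that(1) by (simp add: C_def)
  have Tb: "T \<in> bounded_ops" using T by (simp add: selfadjoint_ops_def)
  have adj: "\<Phi> g \<in> bounded_ops \<and> is_adjoint (\<Phi> g) (\<Phi> (\<lambda>t. cnj (g t)))" if g: "g \<in> C" for g
  proof -
    obtain p where
      p: "uniform_limit (real_spectrum T) (\<lambda>n t. poly (p n) (complex_of_real t)) g sequentially"
        "(\<lambda>n. op_poly T (p n)) \<longlonglongrightarrow> \<Phi> g"
      using lim [OF g] unfolding cfc_limit_def by blast
    define q where "q n = map_poly cnj (p n)" for n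
    have poly_q: "poly (q n) (complex_of_real t) = cnj (poly (p n) (complex_of_real t))" for n t
      using poly_cnj [of "p n" "complex_of_real t"] by (simp add: q_def)
    have adj_q: "is_adjoint (op_poly T (p n)) (op_poly T (q n))" for n
      unfolding q_def by (rule op_poly_adjoint [OF T])
    have cg: "(\<lambda>t. cnj (g t)) \<in> C" using g by (auto simp: C_def intro: continuous_intros)
    \<comment> \<open>Passing to the adjoint does not increase the norm, so the operators of the
      conjugated polynomials inherit the Cauchy property; their limit is the adjoint of
      \<Phi>(g).\<close>
    have "Cauchy (\<lambda>n. op_poly T (q n))"
    proof (rule metric_CauchyI)
      fix e :: real assume "0 < e"
      then obtain M where M: "\<And>m n. m \<ge> M \<Longrightarrow> n \<ge> M \<Longrightarrow> dist (op_poly T (p m)) (op_poly T (p n)) < e"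
        using metric_CauchyD [OF LIMSEQ_imp_Cauchy [OF p(2)]] by blast
      have "is_adjoint (op_poly T (p m - p n)) (op_poly T (q m - q n))" for m n
      proof -
        have "q m - q n = map_poly cnj (p m - p n)"
          by (auto intro!: poly_eqI simp: q_def coeff_map_poly)
        then show ?thesis using op_poly_adjoint [OF T, of "p m - p n"] by simp
      qed
      then have "norm (op_poly T (q m - q n)) \<le> norm (op_poly T (p m - p n))" for m n
        by (rule norm_adjoint_le)
      then have "dist (op_poly T (q m)) (op_poly T (q n)) \<le> dist (op_poly T (p m)) (op_poly T (p n))" for m n
        by (simp add: dist_norm op_poly_diff)
      with M show "\<exists>M. \<forall>m\<ge>M. \<forall>n\<ge>M. dist (op_poly T (q m)) (op_poly T (q n)) < e"
        by (meson le_less_trans)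
    qed
    then obtain R where R: "(\<lambda>n. op_poly T (q n)) \<longlonglongrightarrow> R"
      by (meson Cauchy_convergent_iff convergent_def)
    have "uniform_limit (real_spectrum T) (\<lambda>n t. poly (q n) (complex_of_real t)) (\<lambda>t. cnj (g t)) sequentially"
      using p(1) unfolding uniform_limit_iff dist_norm poly_q complex_cnj_diff [symmetric] complex_mod_cnj .
    with R have "cfc_limit T (\<lambda>t. cnj (g t)) R" unfolding cfc_limit_def by blast
    with uniq [OF cg] have "\<Phi> (\<lambda>t. cnj (g t)) = R" by blast
    moreover have "is_adjoint (\<Phi> g) R"
      using is_adjoint_limit [OF adj_q p(2) R] Tb by simp
    \<comment> \<open>\<open>is_adjoint_limit\<close> yields complex linearity for the right-hand
      limit, hence a second use with the roles exchanged.\<close>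
    moreover have "is_adjoint (op_poly T (q n)) (op_poly T (p n))" for n
      using adj_q [of n] unfolding is_adjoint_def by (metis cinner_commute)
    then have "\<Phi> g \<in> bounded_ops"
      using is_adjoint_limit(1) [OF _ R p(2)] Tb by simp
    ultimately show ?thesis by simp
  qed
  have scale: "\<Phi> (\<lambda>t. c * g t) x = c *\<^sub>C \<Phi> g x" if "g \<in> C" for c g x
  proof -
    have "cfc_limit T (\<lambda>t. poly [:c:] (complex_of_real t) * g t) (op_poly T [:c:] o\<^sub>L \<Phi> g)"
      using that by (intro cfc_limit_mult cfc_limit_poly lim T) (auto simp: C_def)
    then have "\<Phi> (\<lambda>t. c * g t) = op_poly T [:c:] o\<^sub>L \<Phi> g"
      using that by (intro uniq) (auto simp: C_def intro: continuous_intros)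
    then show ?thesis by simp
  qed
  have add: "\<Phi> (\<lambda>t. g t + h t) = \<Phi> g + \<Phi> h" if "g \<in> C" "h \<in> C" for g h
    using that by (intro uniq cfc_limit_add lim) (auto simp: C_def intro: continuous_intros)
  have mult: "\<Phi> (\<lambda>t. g t * h t) = \<Phi> g o\<^sub>L \<Phi> h" if "g \<in> C" "h \<in> C" for g h
    using that by (intro uniq cfc_limit_mult lim T) (auto simp: C_def intro: continuous_intros)
  have cong: "\<Phi> g = \<Phi> h" if "g \<in> C" "h \<in> C" "\<And>t. t \<in> real_spectrum T \<Longrightarrow> g t = h t" for g h
    using that by (intro uniq cfc_limit_cong [OF lim [of h]]) auto
  have one: "\<Phi> (\<lambda>_. 1) = id_blinfun"
    using cfc_limit_poly [of T "[:1:]"] by (intro uniq) (auto simp: C_def scale_op_1)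
  have ident: "\<Phi> complex_of_real = T"
    using cfc_limit_poly [of T "[:0, 1:]"] unfolding op_poly_X
    by (intro uniq) (auto simp: C_def intro: continuous_intros)
  have "is_cfc T \<Phi>"
    unfolding is_cfc_def Let_def C_def [symmetric]
    by (intro conjI ballI allI impI scale add mult one ident cong) (simp_all add: adj)
  then show ?thesis by (intro exI)
qed

section \<open>Uniqueness of the calculus and its identification with \<open>cfc\<close>\<close>

lemma is_cfcD:
  assumes "is_cfc T \<Phi>"
  shows "continuous_on (real_spectrum T) g \<Longrightarrow> \<Phi> g \<in> bounded_ops"
    and "continuous_on (real_spectrum T) g \<Longrightarrow> continuous_on (real_spectrum T) h \<Longrightarrow>
      (\<And>t. t \<in> real_spectrum T \<Longrightarrow> g t = h t) \<Longrightarrow> \<Phi> g = \<Phi> h"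
    and "continuous_on (real_spectrum T) g \<Longrightarrow> continuous_on (real_spectrum T) h \<Longrightarrow>
      \<Phi> (\<lambda>t. g t + h t) = \<Phi> g + \<Phi> h"
    and "continuous_on (real_spectrum T) g \<Longrightarrow>
      blinfun_apply (\<Phi> (\<lambda>t. c * g t)) x = c *\<^sub>C blinfun_apply (\<Phi> g) x"
    and "continuous_on (real_spectrum T) g \<Longrightarrow> continuous_on (real_spectrum T) h \<Longrightarrow>
      \<Phi> (\<lambda>t. g t * h t) = (\<Phi> g o\<^sub>L \<Phi> h)"
    and "continuous_on (real_spectrum T) g \<Longrightarrow> is_adjoint (\<Phi> g) (\<Phi> (\<lambda>t. cnj (g t)))"
    and "\<Phi> (\<lambda>_. 1) = id_blinfun"
    and "\<Phi> complex_of_real = T"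
proof -
  note A1 = assms [unfolded is_cfc_def Let_def Ball_def mem_Collect_eq]
  note A2 = conjunct2 [OF A1] note A3 = conjunct2 [OF A2] note A4 = conjunct2 [OF A3]
  note A5 = conjunct2 [OF A4] note A6 = conjunct2 [OF A5] note A7 = conjunct2 [OF A6]
  show "continuous_on (real_spectrum T) g \<Longrightarrow> \<Phi> g \<in> bounded_ops"
    by (rule conjunct1 [OF A1, rule_format])
  show "continuous_on (real_spectrum T) g \<Longrightarrow> continuous_on (real_spectrum T) h \<Longrightarrow>
      (\<And>t. t \<in> real_spectrum T \<Longrightarrow> g t = h t) \<Longrightarrow> \<Phi> g = \<Phi> h"
    by (rule conjunct1 [OF A2, rule_format])
  show "continuous_on (real_spectrum T) g \<Longrightarrow> continuous_on (real_spectrum T) h \<Longrightarrow>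
      \<Phi> (\<lambda>t. g t + h t) = \<Phi> g + \<Phi> h"
    by (rule conjunct1 [OF A3, rule_format])
  show "continuous_on (real_spectrum T) g \<Longrightarrow>
      blinfun_apply (\<Phi> (\<lambda>t. c * g t)) x = c *\<^sub>C blinfun_apply (\<Phi> g) x"
    by (rule conjunct1 [OF A4, rule_format])
  show "continuous_on (real_spectrum T) g \<Longrightarrow> continuous_on (real_spectrum T) h \<Longrightarrow>
      \<Phi> (\<lambda>t. g t * h t) = (\<Phi> g o\<^sub>L \<Phi> h)"
    by (rule conjunct1 [OF A5, rule_format])
  show "continuous_on (real_spectrum T) g \<Longrightarrow> is_adjoint (\<Phi> g) (\<Phi> (\<lambda>t. cnj (g t)))"
    by (rule conjunct1 [OF A6, rule_format])
  show "\<Phi> (\<lambda>_. 1) = id_blinfun" by (rule conjunct1 [OF A7])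
  show "\<Phi> complex_of_real = T" by (rule conjunct2 [OF A7])
qed

text \<open>\<open>is_cfc\<close> demands no continuity; contractivity follows algebraically. With h
  = sqrt(e^2 - |g|^2) one has h^2 + |g|^2 = e^2 on the spectrum, so ||\<Phi>(h) x||^2 + ||\<Phi>(g)
  x||^2 = e^2 ||x||^2.\<close>

lemma is_cfc_norm_le:
  fixes T :: "'a::chilbert_space \<Rightarrow>\<^sub>L 'a"
  assumes \<Phi>: "is_cfc T \<Phi>" and g: "continuous_on (real_spectrum T) g"
    and le: "\<And>t. t \<in> real_spectrum T \<Longrightarrow> cmod (g t) \<le> e" and "0 \<le> e"
  shows "norm (\<Phi> g) \<le> e"
proof (rule norm_blinfun_bound [OF \<open>0 \<le> e\<close>])
  fix x
  define h where "h t = complex_of_real (sqrt (e\<^sup>2 - (cmod (g t))\<^sup>2))" for t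
  define k where "k t = cnj (g t) * g t" for t
  have h: "continuous_on (real_spectrum T) h" and k: "continuous_on (real_spectrum T) k"
    unfolding h_def k_def by (intro continuous_intros g)+
  have cg: "continuous_on (real_spectrum T) (\<lambda>t. cnj (g t))"
    by (intro continuous_intros g)
  have hh: "h t * h t + k t = complex_of_real (e\<^sup>2) * 1" if t: "t \<in> real_spectrum T" for t
  proof -
    have "(cmod (g t))\<^sup>2 \<le> e\<^sup>2" using le [OF t] by (intro power_mono) auto
    then have "h t * h t = complex_of_real (e\<^sup>2 - (cmod (g t))\<^sup>2)"
      by (simp add: h_def flip: of_real_mult)
    moreover have "k t = complex_of_real ((cmod (g t))\<^sup>2)"
      using complex_norm_square [of "g t"] by (simp add: k_def mult.commute)
    ultimately show ?thesis by simp
  qed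
  have "\<Phi> (\<lambda>t. h t * h t + k t) = \<Phi> (\<lambda>t. complex_of_real (e\<^sup>2) * 1)"
    by (rule is_cfcD(2) [OF \<Phi>]) (intro continuous_intros h k hh | assumption)+
  then have "\<Phi> (\<lambda>t. h t * h t + k t) x = complex_of_real (e\<^sup>2) *\<^sub>C x"
    using is_cfcD(4) [OF \<Phi>, of "\<lambda>_. 1" "complex_of_real (e\<^sup>2)" x] by (simp add: is_cfcD(7) [OF \<Phi>])
  moreover have "\<Phi> (\<lambda>t. h t * h t + k t) = (\<Phi> h o\<^sub>L \<Phi> h) + (\<Phi> (\<lambda>t. cnj (g t)) o\<^sub>L \<Phi> g)"
    unfolding k_def
    by (subst is_cfcD(3) [OF \<Phi>]) (intro continuous_intros h g | simp add: is_cfcD(5) [OF \<Phi>] h g cg)+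
  ultimately have "\<Phi> h (\<Phi> h x) + \<Phi> (\<lambda>t. cnj (g t)) (\<Phi> g x) = e\<^sup>2 *\<^sub>R x"
    by (simp add: blinfun.add_left flip: scaleC_of_real)
  then have "x \<bullet> \<Phi> h (\<Phi> h x) + x \<bullet> \<Phi> (\<lambda>t. cnj (g t)) (\<Phi> g x) = e\<^sup>2 * (norm x)\<^sup>2"
    by (metis inner_add_right inner_scaleR_right power2_norm_eq_inner)
  moreover have "x \<bullet> \<Phi> h (\<Phi> h x) = (norm (\<Phi> h x))\<^sup>2"
  proof -
    have "(\<lambda>t. cnj (h t)) = h" by (rule ext) (simp add: h_def)
    then show ?thesis
      using is_adjointD [OF is_cfcD(6) [OF \<Phi> h], of x "\<Phi> h x"] by (simp add: power2_norm_eq_inner)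
  qed
  moreover have "x \<bullet> \<Phi> (\<lambda>t. cnj (g t)) (\<Phi> g x) = (norm (\<Phi> g x))\<^sup>2"
    using is_adjointD [OF is_cfcD(6) [OF \<Phi> g], of x "\<Phi> g x"]
    by (simp add: power2_norm_eq_inner)
  moreover have "0 \<le> (norm (\<Phi> h x))\<^sup>2" by simp
  ultimately have "(norm (\<Phi> g x))\<^sup>2 \<le> (e * norm x)\<^sup>2"
    unfolding power_mult_distrib by linarith
  then show "norm (\<Phi> g x) \<le> e * norm x"
    using \<open>0 \<le> e\<close> by (simp add: power2_le_iff_abs_le)
qed

text \<open>Two calculi agree on polynomials by induction, and contractivity carries this over to
  uniform limits.\<close>

lemma is_cfc_unique:
  fixes T :: "'a::chilbert_space \<Rightarrow>\<^sub>L 'a"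
  assumes T: "T \<in> selfadjoint_ops" and \<Phi>: "is_cfc T \<Phi>" and \<Psi>: "is_cfc T \<Psi>"
    and g: "continuous_on (real_spectrum T) g"
  shows "\<Phi> g = \<Psi> g"
proof -
  have poly: "\<Theta> (\<lambda>t. poly p (complex_of_real t)) = op_poly T p" if \<Theta>: "is_cfc T \<Theta>" for p \<Theta>
  proof (induction p)
    case 0
    have "\<Theta> (\<lambda>t. 0 * 1) x = 0" for x
      using is_cfcD(4) [OF \<Theta>, of "\<lambda>_. 1" 0 x] by simp
    then show ?case by (auto intro: blinfun_eqI)
  next
    case (pCons a p)
    have "\<Theta> (\<lambda>t. poly (pCons a p) (complex_of_real t))
        = \<Theta> (\<lambda>t. a * 1) + \<Theta> (\<lambda>t. complex_of_real t * poly p (complex_of_real t))"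
      unfolding poly_pCons by (subst is_cfcD(3) [OF \<Theta>, symmetric]) (auto intro!: continuous_intros)
    also have "\<Theta> (\<lambda>t. complex_of_real t * poly p (complex_of_real t)) = (T o\<^sub>L op_poly T p)"
      by (subst is_cfcD(5) [OF \<Theta>]) (auto intro!: continuous_intros simp: pCons is_cfcD(8) [OF \<Theta>])
    also have "\<Theta> (\<lambda>t. a * 1) = scale_op a"
      using is_cfcD(4) [OF \<Theta>, of "\<lambda>_. 1" a] by (intro blinfun_eqI) (simp add: is_cfcD(7) [OF \<Theta>])
    finally show ?case by simp
  qed
  have diff: "norm (\<Theta> g - op_poly T p) \<le> e"
    if \<Theta>: "is_cfc T \<Theta>" and p: "\<forall>t\<in>real_spectrum T. cmod (poly p (complex_of_real t) - g t) < e" and "0 < e"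
    for p e \<Theta>
  proof -
    have "\<Theta> (\<lambda>t. g t + (- 1) * poly p (complex_of_real t)) = \<Theta> g + \<Theta> (\<lambda>t. (- 1) * poly p (complex_of_real t))"
      by (subst is_cfcD(3) [OF \<Theta>]) (auto intro!: continuous_intros g)
    also have "\<Theta> (\<lambda>t. (- 1) * poly p (complex_of_real t)) = - op_poly T p"
    proof (rule blinfun_eqI)
      fix x
      show "\<Theta> (\<lambda>t. (- 1) * poly p (complex_of_real t)) x = (- op_poly T p) x"
        by (subst is_cfcD(4) [OF \<Theta>]) (auto intro!: continuous_intros simp: poly [OF \<Theta>] scaleC_minus_left blinfun.minus_left)
    qed
    finally have "\<Theta> (\<lambda>t. g t + (- 1) * poly p (complex_of_real t)) = \<Theta> g - op_poly T p" by simp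
    moreover have "norm (\<Theta> (\<lambda>t. g t + (- 1) * poly p (complex_of_real t))) \<le> e"
    proof (rule is_cfc_norm_le [OF \<Theta>])
      show "continuous_on (real_spectrum T) (\<lambda>t. g t + (- 1) * poly p (complex_of_real t))"
        by (intro continuous_intros g)
      show "cmod (g t + (- 1) * poly p (complex_of_real t)) \<le> e" if "t \<in> real_spectrum T" for t
        using p that norm_minus_commute [of "g t" "poly p (complex_of_real t)"] by (auto intro: less_imp_le)
    qed (use \<open>0 < e\<close> in simp)
    ultimately show ?thesis by simp
  qed
  have "norm (\<Phi> g - \<Psi> g) \<le> 0"
  proof (rule field_le_epsilon)
    fix e :: real assume "0 < e"
    obtain p where p: "\<forall>t\<in>real_spectrum T. cmod (poly p (complex_of_real t) - g t) < e / 2"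
      using complex_polynomial_approximation [OF compact_real_spectrum [OF T] g, of "e / 2"] \<open>0 < e\<close> by auto
    show "norm (\<Phi> g - \<Psi> g) \<le> 0 + e"
      using diff [OF \<Phi> p] diff [OF \<Psi> p] \<open>0 < e\<close>
        norm_triangle_ineq4 [of "\<Phi> g - op_poly T p" "\<Psi> g - op_poly T p"] by simp
  qed
  then show ?thesis by simp
qed

text \<open>Existence and uniqueness make the definite description in \<open>cfc_def\<close> denote.
  Agreement with \<Phi> is established for continuous functions, so the axioms are transferred one
  at a time.\<close>

lemma is_cfc_cfc:
  fixes T :: "'a::chilbert_space \<Rightarrow>\<^sub>L 'a"
  assumes T: "T \<in> selfadjoint_ops"
  shows "is_cfc T (\<lambda>g. cfc g T)"
proof -
  obtain \<Phi> where \<Phi>: "is_cfc T \<Phi>" using is_cfc_exists [OF T] by blast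
  have eq: "cfc g T = \<Phi> g" if "continuous_on (real_spectrum T) g" for g
    unfolding cfc_def
    by (rule the_equality) (use \<Phi> is_cfc_unique [OF T _ \<Phi> that] in blast)+
  have cnj_cont: "continuous_on K (\<lambda>t. cnj (g t))" if "continuous_on K g" for K and g :: "real \<Rightarrow> complex"
    by (intro continuous_intros that)
  define C :: "(real \<Rightarrow> complex) set" where "C = {g. continuous_on (real_spectrum T) g}"
  have "cfc g T \<in> bounded_ops" if "g \<in> C" for g
    using that is_cfcD(1) [OF \<Phi>] by (simp add: C_def eq)
  moreover have "cfc g T = cfc h T" if "g \<in> C" "h \<in> C" "\<forall>t\<in>real_spectrum T. g t = h t" for g h
    using that is_cfcD(2) [OF \<Phi>, of g h] by (simp add: C_def eq)
  moreover have "cfc (\<lambda>t. g t + h t) T = cfc g T + cfc h T" if "g \<in> C" "h \<in> C" for g h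
    using that is_cfcD(3) [OF \<Phi>, of g h] by (simp add: C_def eq continuous_on_add)
  moreover have "cfc (\<lambda>t. c * g t) T x = c *\<^sub>C cfc g T x" if "g \<in> C" for c g x
    using that is_cfcD(4) [OF \<Phi>, of g c x] by (simp add: C_def eq continuous_on_mult_left)
  moreover have "cfc (\<lambda>t. g t * h t) T = (cfc g T o\<^sub>L cfc h T)" if "g \<in> C" "h \<in> C" for g h
    using that is_cfcD(5) [OF \<Phi>, of g h] by (simp add: C_def eq continuous_on_mult)
  moreover have "is_adjoint (cfc g T) (cfc (\<lambda>t. cnj (g t)) T)" if "g \<in> C" for g
    using that is_cfcD(6) [OF \<Phi>, of g] cnj_cont by (simp add: C_def eq)
  moreover have "cfc (\<lambda>_. 1) T = id_blinfun"
    using is_cfcD(7) [OF \<Phi>] by (simp add: eq)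
  moreover have "cfc complex_of_real T = T"
    using is_cfcD(8) [OF \<Phi>] eq [of complex_of_real] by (simp add: continuous_on_of_real_id)
  ultimately show ?thesis
    unfolding is_cfc_def Let_def C_def [symmetric] by (intro conjI ballI allI impI)
qed

section \<open>Real functions of a self-adjoint operator\<close>

text \<open>Real functions of \<open>T\<close> are symmetric for the real inner product, so the
  convergence argument can be run on real quadratic forms.\<close>

definition rfc :: "(real \<Rightarrow> real) \<Rightarrow> ('a::chilbert_space \<Rightarrow>\<^sub>L 'a) \<Rightarrow> ('a \<Rightarrow>\<^sub>L 'a)"
  where "rfc g T = cfc (\<lambda>t. complex_of_real (g t)) T"

context
  fixes T :: "'a::chilbert_space \<Rightarrow>\<^sub>L 'a"
  assumes T: "T \<in> selfadjoint_ops"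
begin

lemma rfc_cong:
  assumes "continuous_on (real_spectrum T) g" "\<And>t. t \<in> real_spectrum T \<Longrightarrow> g t = h t"
  shows "rfc g T = rfc h T"
  unfolding rfc_def
proof (rule is_cfcD(2) [OF is_cfc_cfc [OF T]])
  have "continuous_on (real_spectrum T) h"
    using continuous_on_eq [OF assms] by simp
  then show "continuous_on (real_spectrum T) (\<lambda>t. complex_of_real (h t))"
    by (intro continuous_intros)
  show "continuous_on (real_spectrum T) (\<lambda>t. complex_of_real (g t))"
    by (intro continuous_intros assms)
qed (simp add: assms(2))

lemma rfc_ident: "rfc (\<lambda>t. t) T = T"
  unfolding rfc_def
  by (rule is_cfcD(8) [OF is_cfc_cfc [OF T]])

lemma rfc_add:
  assumes "continuous_on (real_spectrum T) g" "continuous_on (real_spectrum T) h"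
  shows "rfc (\<lambda>t. g t + h t) T x = rfc g T x + rfc h T x"
  by (simp add: rfc_def is_cfcD(3) [OF is_cfc_cfc [OF T]] assms continuous_on_of_real blinfun.add_left)

lemma rfc_cmult:
  assumes "continuous_on (real_spectrum T) g"
  shows "rfc (\<lambda>t. c * g t) T x = c *\<^sub>R rfc g T x"
  by (simp add: rfc_def is_cfcD(4) [OF is_cfc_cfc [OF T]] assms continuous_on_of_real scaleC_of_real)

lemma rfc_const: "rfc (\<lambda>_. c) T x = c *\<^sub>R x"
  using is_cfcD(4) [OF is_cfc_cfc [OF T], of "\<lambda>_. 1" "complex_of_real c" x]
  by (simp add: rfc_def is_cfcD(7) [OF is_cfc_cfc [OF T]] scaleC_of_real)

lemma rfc_diff:
  assumes "continuous_on (real_spectrum T) g" "continuous_on (real_spectrum T) h"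
  shows "rfc (\<lambda>t. g t - h t) T x = rfc g T x - rfc h T x"
  using rfc_add [of g "\<lambda>t. (- 1) * h t"] rfc_cmult [of h "- 1"] assms
  by (simp add: continuous_on_minus)

lemma rfc_mult:
  assumes "continuous_on (real_spectrum T) g" "continuous_on (real_spectrum T) h"
  shows "rfc (\<lambda>t. g t * h t) T x = rfc g T (rfc h T x)"
  by (simp add: rfc_def is_cfcD(5) [OF is_cfc_cfc [OF T]] assms continuous_on_of_real)

lemma rfc_sum:
  assumes "finite J" "\<And>j. j \<in> J \<Longrightarrow> continuous_on (real_spectrum T) (g j)"
  shows "rfc (\<lambda>t. \<Sum>j\<in>J. g j t) T x = (\<Sum>j\<in>J. rfc (g j) T x)"
  using assms
proof (induction J rule: finite_induct)
  case empty
  show ?case using rfc_const [of 0] by simp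
next
  case (insert a J)
  then show ?case
    using rfc_add [of "g a" "\<lambda>t. \<Sum>j\<in>J. g j t" x] by (simp add: continuous_on_sum)
qed

lemma rfc_symmetric:
  assumes "continuous_on (real_spectrum T) g"
  shows "rfc g T x \<bullet> y = x \<bullet> rfc g T y"
  using is_adjointD [OF is_cfcD(6) [OF is_cfc_cfc [OF T], of "\<lambda>t. complex_of_real (g t)"]] assms
  by (simp add: rfc_def continuous_on_of_real)

lemma inner_rfc_square:
  assumes "continuous_on (real_spectrum T) g"
  shows "x \<bullet> rfc (\<lambda>t. (g t)\<^sup>2) T x = (norm (rfc g T x))\<^sup>2"
  unfolding power2_eq_square rfc_mult [OF assms assms]
  by (simp add: dot_square_norm power2_eq_square flip: rfc_symmetric [OF assms, of x])

text \<open>With k = sqrt(h - g), the difference of the two quadratic forms is ||k(T) x||^2.\<close>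

lemma inner_rfc_mono:
  assumes g: "continuous_on (real_spectrum T) g" and h: "continuous_on (real_spectrum T) h"
    and le: "\<And>t. t \<in> real_spectrum T \<Longrightarrow> g t \<le> h t"
  shows "x \<bullet> rfc g T x \<le> x \<bullet> rfc h T x"
proof -
  define k where "k t = sqrt (h t - g t)" for t
  have k: "continuous_on (real_spectrum T) k" unfolding k_def by (intro continuous_intros g h)
  have "rfc (\<lambda>t. h t - g t) T = rfc (\<lambda>t. (k t)\<^sup>2) T"
    by (rule rfc_cong) (auto intro!: continuous_intros g h simp: k_def le)
  then have "x \<bullet> rfc (\<lambda>t. h t - g t) T x \<ge> 0"
    using inner_rfc_square [OF k, of x] by (metis zero_le_power2)
  then show ?thesis by (simp add: rfc_diff [OF h g] inner_diff_right)
qed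

lemma cfc_Re_Im:
  assumes "continuous_on (real_spectrum T) \<phi>"
  shows "cfc \<phi> T x = rfc (\<lambda>t. Re (\<phi> t)) T x + \<i> *\<^sub>C rfc (\<lambda>t. Im (\<phi> t)) T x"
proof -
  note C = is_cfcD [OF is_cfc_cfc [OF T]]
  have c: "continuous_on (real_spectrum T) (\<lambda>t. complex_of_real (Re (\<phi> t)))"
      "continuous_on (real_spectrum T) (\<lambda>t. complex_of_real (Im (\<phi> t)))"
    by (intro continuous_intros assms)+
  have "cfc \<phi> T = cfc (\<lambda>t. complex_of_real (Re (\<phi> t)) + \<i> * complex_of_real (Im (\<phi> t))) T"
    by (simp flip: complex_eq)
  then show ?thesis
    using C(3) [OF c(1) continuous_on_mult_left [OF c(2), of \<i>]] C(4) [OF c(2), of \<i> x]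
    by (simp add: rfc_def blinfun.add_left)
qed

end

section \<open>Support lines of a strictly convex function\<close>

lemma strictly_convex_onD:
  assumes "strictly_convex_on I f" "x \<in> I" "y \<in> I" "x \<noteq> y" "0 < u" "u < 1"
  shows "f ((1 - u) * x + u * y) < (1 - u) * f x + u * f y"
  using assms unfolding strictly_convex_on_def by blast

lemma strictly_convex_imp_convex:
  assumes "strictly_convex_on I f"
  shows "convex_on I f"
  unfolding convex_on_def
proof (intro conjI ballI allI impI)
  show "convex I" using assms by (simp add: strictly_convex_on_def)
  fix x y u v :: real assume *: "x \<in> I" "y \<in> I" "0 \<le> u" "0 \<le> v" "u + v = 1"
  then have u: "u = 1 - v" by simp
  show "f (u *\<^sub>R x + v *\<^sub>R y) \<le> u * f x + v * f y"
  proof (cases "x = y \<or> v = 0 \<or> v = 1")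
    case True
    then show ?thesis
    proof (elim disjE)
      assume "x = y"
      then have "u *\<^sub>R x + v *\<^sub>R y = x" "u * f x + v * f y = f x"
        using * by (simp_all flip: distrib_right)
      then show ?thesis by simp
    qed (use * in auto)
  next
    case False
    with * have "f ((1 - v) * x + v * y) < (1 - v) * f x + v * f y"
      by (intro strictly_convex_onD [OF assms]) auto
    then show ?thesis by (simp add: u)
  qed
qed

text \<open>Estimates on [a, b] must also reach points of I slightly beyond b. If b is the greatest
  element there are none and b itself serves; otherwise there is room up to some larger
  point.\<close>

lemma extend_interval_right:
  fixes I :: "real set"
  assumes "b \<in> I"
  obtains b' \<delta> where "b' \<in> I" "b \<le> b'" "0 < \<delta>" "\<And>t. t \<in> I \<Longrightarrow> t \<le> b + \<delta> \<Longrightarrow> t \<le> b'"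
proof (cases "\<exists>z\<in>I. b < z")
  case True
  then obtain z where "z \<in> I" "b < z" by blast
  then show ?thesis by (intro that [of z "z - b"]) auto
next
  case False
  then show ?thesis using assms by (intro that [of b 1]) force+
qed

lemma extend_interval_left:
  fixes I :: "real set"
  assumes "a \<in> I"
  obtains a' \<delta> where "a' \<in> I" "a' \<le> a" "0 < \<delta>" "\<And>t. t \<in> I \<Longrightarrow> a - \<delta> \<le> t \<Longrightarrow> a' \<le> t"
proof (cases "\<exists>z\<in>I. z < a")
  case True
  then obtain z where "z \<in> I" "z < a" by blast
  then show ?thesis by (intro that [of z "a - z"]) auto
next
  case False
  then show ?thesis using assms by (intro that [of a 1]) force+
qed

text \<open>The second difference of \<open>f\<close> on a segment of length \<open>\<rho>\<close> does not change when a support line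
  is subtracted, so it bounds the distance to the support line at either end of the segment.\<close>

lemma strictly_convex_support_line_gap:
  assumes I: "is_interval I" and sc: "strictly_convex_on I f" and cont: "continuous_on I f"
    and ab: "a \<in> I" "b \<in> I" and "0 < r"
  shows "\<exists>c>0. \<forall>s\<in>{a..b}. \<forall>m. (\<forall>t\<in>I. f s + m * (t - s) \<le> f t) \<longrightarrow>
    (\<forall>t\<in>I. r \<le> \<bar>t - s\<bar> \<longrightarrow> c \<le> f t - f s - m * (t - s))"
proof -
  obtain b' d1 where b': "b' \<in> I" "b \<le> b'" "0 < d1" "\<And>t. t \<in> I \<Longrightarrow> t \<le> b + d1 \<Longrightarrow> t \<le> b'"
    using extend_interval_right [OF ab(2)] by blast
  obtain a' d2 where a': "a' \<in> I" "a' \<le> a" "0 < d2" "\<And>t. t \<in> I \<Longrightarrow> a - d2 \<le> t \<Longrightarrow> a' \<le> t"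
    using extend_interval_left [OF ab(1)] by blast
  have sub: "t \<in> I" if "u \<in> I" "v \<in> I" "u \<le> t" "t \<le> v" for t u v
    using I that by (meson mem_is_interval_1_I)
  \<comment> \<open>\<rho> \<le> r places the point at distance \<rho> between s and t, while \<rho>
    \<le> d1 and \<rho> \<le> d2 keep it inside [a', b'].\<close>
  define \<rho> where "\<rho> = min r (min d1 d2)"
  have \<rho>: "0 < \<rho>" "\<rho> \<le> r" "\<rho> \<le> d1" "\<rho> \<le> d2"
    using \<open>0 < r\<close> b'(3) a'(3) by (auto simp: \<rho>_def)
  define D where "D p = f (p + \<rho>) - 2 * f (p + \<rho> / 2) + f p" for p
  have Dpos: "0 < D p" if "p \<in> I" "p + \<rho> \<in> I" for p
  proof -
    have "f ((1 - 1 / 2) * p + 1 / 2 * (p + \<rho>)) < (1 - 1 / 2) * f p + 1 / 2 * f (p + \<rho>)"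
      using that \<rho>(1) by (intro strictly_convex_onD [OF sc]) auto
    moreover have "(1 - 1 / 2) * p + 1 / 2 * (p + \<rho>) = p + \<rho> / 2" by (simp add: field_simps)
    ultimately show ?thesis by (simp add: D_def)
  qed
  \<comment> \<open>Compactness gives a positive minimum of the second difference; if no segment of
    length \<rho> fits, any constant works.\<close>
  have "\<exists>c>0. \<forall>p\<in>{a'..b' - \<rho>}. c \<le> D p"
  proof (cases "{a'..b' - \<rho>} = {}")
    case True
    then show ?thesis by (intro exI [of _ 1]) simp
  next
    case False
    have "continuous_on {a'..b' - \<rho>} D"
      unfolding D_def
      by (intro continuous_intros continuous_on_compose2 [OF cont])
        (use \<rho>(1) sub [OF a'(1) b'(1)] in auto)
    then obtain p where p: "p \<in> {a'..b' - \<rho>}" "\<forall>q\<in>{a'..b' - \<rho>}. D p \<le> D q"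
      using continuous_attains_inf [of "{a'..b' - \<rho>}" D] False by auto
    have "0 < D p"
      using p(1) \<rho>(1) sub [OF a'(1) b'(1)] by (intro Dpos) auto
    with p(2) show ?thesis by blast
  qed
  then obtain c where c: "0 < c" "\<And>p. a' \<le> p \<Longrightarrow> p + \<rho> \<le> b' \<Longrightarrow> c \<le> D p"
    by (metis atLeastAtMost_iff le_diff_eq)
  have "c \<le> f t - f s - m * (t - s)"
    if s: "a \<le> s" "s \<le> b" and m: "\<And>t. t \<in> I \<Longrightarrow> f s + m * (t - s) \<le> f t"
      and t: "t \<in> I" "r \<le> \<bar>t - s\<bar>" for s m t
  proof -
    define g where "g x = f x - f s - m * (x - s)" for x
    have sI: "s \<in> I" using sub [OF ab s] .
    have g0: "0 \<le> g x" if "x \<in> I" for x using m [OF that] by (simp add: g_def)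
    have Dg: "D p = g (p + \<rho>) - 2 * g (p + \<rho> / 2) + g p" for p
      by (simp add: D_def g_def field_simps)
    define u where "u = \<rho> / \<bar>t - s\<bar>"
    have u: "0 < u" "u \<le> 1" using \<rho> t(2) by (auto simp: u_def field_simps)
    \<comment> \<open>q lies at distance \<rho> from s towards t; convexity of g with g(s) = 0 gives
      g(q) \<le> g(t).\<close>
    define q where "q = s + u * (t - s)"
    have "f ((1 - u) *\<^sub>R s + u *\<^sub>R t) \<le> (1 - u) * f s + u * f t"
      using sI t(1) u by (intro convex_onD [OF strictly_convex_imp_convex [OF sc]]) auto
    moreover have "(1 - u) *\<^sub>R s + u *\<^sub>R t = q" by (simp add: q_def algebra_simps)
    ultimately have "g q \<le> u * g t" by (simp add: g_def q_def algebra_simps)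
    also have "\<dots> \<le> g t" using u g0 [OF t(1)] by (simp add: mult_left_le_one_le)
    finally have gq: "g q \<le> g t" .
    have "c \<le> g q"
    proof (cases "s < t")
      case True
      then have q: "q = s + \<rho>" by (simp add: q_def u_def)
      have "s + \<rho> \<in> I" using True \<rho> t by (intro sub [OF sI t(1)]) auto
      moreover then have "s + \<rho> \<le> b'" using s \<rho> by (intro b'(4)) auto
      moreover have "s + \<rho> / 2 \<in> I" using True \<rho> t by (intro sub [OF sI t(1)]) auto
      ultimately have "c \<le> D s" "0 \<le> g (s + \<rho> / 2)" using c(2) [of s] a'(2) s(1) g0 by auto
      then show ?thesis by (simp add: Dg q) (simp add: g_def)
    next
      case False
      then have lt: "t < s" using t \<rho> by auto
      then have q: "q = s - \<rho>" by (simp add: q_def u_def field_simps)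
      have "s - \<rho> \<in> I" using lt \<rho> t by (intro sub [OF t(1) sI]) auto
      moreover then have "a' \<le> s - \<rho>" using s \<rho> by (intro a'(4)) auto
      moreover have "s - \<rho> / 2 \<in> I" using lt \<rho> t by (intro sub [OF t(1) sI]) auto
      ultimately have "c \<le> D (s - \<rho>)" "0 \<le> g (s - \<rho> / 2)" using c(2) [of "s - \<rho>"] b'(2) s(2) g0 by auto
      moreover have "s - \<rho> + \<rho> / 2 = s - \<rho> / 2" by (simp add: field_simps)
      ultimately show ?thesis by (simp add: Dg q) (simp add: g_def)
    qed
    with gq show ?thesis by (simp add: g_def)
  qed
  with c(1) show ?thesis by (intro exI [of _ c]) auto
qed

section \<open>Piecewise linear partitions of unity adapted to support lines\<close>

definition clamp01 :: "real \<Rightarrow> real"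
  where "clamp01 x = max 0 (min 1 x)"

lemma clamp01_simps [simp]:
  "0 \<le> clamp01 x" "clamp01 x \<le> 1" "x \<le> 0 \<Longrightarrow> clamp01 x = 0" "1 \<le> x \<Longrightarrow> clamp01 x = 1"
  by (auto simp: clamp01_def)

lemma clamp01_mono: "x \<le> y \<Longrightarrow> clamp01 x \<le> clamp01 y"
  by (auto simp: clamp01_def)

lemma continuous_on_clamp01: "continuous_on S g \<Longrightarrow> continuous_on S (\<lambda>t. clamp01 (g t))"
  unfolding clamp01_def by (intro continuous_intros)

text \<open>On a uniform grid the error of the support line at a grid point over the two adjacent cells is
  at most a second difference of \<open>f\<close>; these errors telescope.\<close>

lemma support_line_partition:
  assumes I: "is_interval I" and cv: "convex_on I f" and cont: "continuous_on I f"
    and ab: "a \<in> I" "b \<in> I" "a < b" and "0 < \<epsilon>" "0 < \<delta>"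
  obtains n :: nat and s m :: "nat \<Rightarrow> real" and p :: "nat \<Rightarrow> real \<Rightarrow> real" and e :: "nat \<Rightarrow> real" where
    "\<And>j. j < n \<Longrightarrow> s j \<in> {a..b}"
    "\<And>j t. j < n \<Longrightarrow> t \<in> I \<Longrightarrow> f (s j) + m j * (t - s j) \<le> f t"
    "\<And>j. continuous_on UNIV (p j)"
    "\<And>j t. 0 \<le> p j t" "\<And>j t. p j t \<le> 1"
    "\<And>t. (\<Sum>j<n. p j t) = 1"
    "\<And>j t. j < n \<Longrightarrow> t \<in> {a..b} \<Longrightarrow> p j t \<noteq> 0 \<Longrightarrow>
      \<bar>t - s j\<bar> \<le> \<delta> \<and> f t - f (s j) - m j * (t - s j) \<le> e j"
    "\<And>j. j < n \<Longrightarrow> 0 \<le> e j" "(\<Sum>j<n. e j) \<le> \<epsilon>"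
proof -
  have sub: "t \<in> I" if "t \<in> {a..b}" for t
    using I ab that by (meson atLeastAtMost_iff mem_is_interval_1_I)
  have "uniformly_continuous_on {a..b} f"
    using cont sub by (intro compact_uniformly_continuous continuous_on_subset [OF cont]) auto
  then obtain d where d: "0 < d" "\<And>x y. x \<in> {a..b} \<Longrightarrow> y \<in> {a..b} \<Longrightarrow> \<bar>x - y\<bar> < d \<Longrightarrow> \<bar>f x - f y\<bar> < \<epsilon> / 2"
    unfolding uniformly_continuous_on_def dist_real_def using \<open>0 < \<epsilon>\<close> by (metis half_gt_zero)
  obtain n where n: "(b - a) / min d \<delta> < real n"
    using reals_Archimedean2 by blast
  have dd: "0 < min d \<delta>" using d(1) \<open>0 < \<delta>\<close> by simp
  have "0 < (b - a) / min d \<delta>" using ab(3) dd by simp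
  then have n0: "0 < n" using n by (metis gr0I less_asym of_nat_0)
  \<comment> \<open>With n + 1 cells there are n interior grid points \<open>x (Suc j)\<close>, and
    a support line exists at each interior point of I.\<close>
  define h where "h = (b - a) / real (Suc n)"
  have h: "0 < h" "real (Suc n) * h = b - a" using ab(3) by (auto simp: h_def)
  have hd: "h < d" "h \<le> \<delta>"
  proof -
    have "(b - a) < real n * min d \<delta>" using n dd by (simp add: pos_divide_less_eq)
    also have "\<dots> \<le> real (Suc n) * min d \<delta>" using dd by simp
    finally have "real (Suc n) * h < real (Suc n) * min d \<delta>" unfolding h(2) .
    then have "h < min d \<delta>" by (rule mult_left_less_imp_less) simp
    then show "h < d" "h \<le> \<delta>" by auto
  qed
  define x where "x k = a + real k * h" for k
  have x_Suc: "x (Suc k) = x k + h" for k by (simp add: x_def algebra_simps)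
  have x0: "x 0 = a" and xn: "x (Suc n) = b" using h(2) by (simp_all add: x_def)
  have x_le: "x k \<le> x l" if "k \<le> l" for k l using that h(1) by (simp add: x_def mult_right_mono)
  have x_mem: "x k \<in> {a..b}" if "k \<le> Suc n" for k
    using x_le [of 0 k] x_le [OF that] by (simp add: x0 xn)
  have "\<exists>\<mu>. \<forall>t\<in>I. f (x (Suc j)) + \<mu> * (t - x (Suc j)) \<le> f t" if "j < n" for j
  proof -
    have "a < x (Suc j)" "x (Suc j) < b"
      using h(1) x_le [of 0 j] x_le [of "Suc (Suc j)" "Suc n"] that x_Suc [of j] x_Suc [of "Suc j"]
      by (auto simp: x0 xn)
    then have "x (Suc j) \<in> interior {a..b}" by (simp add: interior_atLeastAtMost_real)
    then have "x (Suc j) \<in> interior I" using sub interior_mono [of "{a..b}" I] by blast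
    then show ?thesis using convex_le_Inf_differential [OF cv] by blast
  qed
  then obtain m where m: "\<And>j t. j < n \<Longrightarrow> t \<in> I \<Longrightarrow> f (x (Suc j)) + m j * (t - x (Suc j)) \<le> f t"
    by metis
  \<comment> \<open>C k ramps from 0 to 1 over cell k, and successive differences are tents over two
    adjacent cells. Setting C 0 = 1 and C n = 0 extends the outer pieces by the value 1, so the sum
    telescopes to 1 on the whole line.\<close>
  define C where "C k t = (if k = 0 then 1 else if k = n then 0 else clamp01 ((t - x k) / h))" for k t
  define p where "p j t = (if j < n then C j t - C (Suc j) t else 0)" for j t
  define g where "g j t = f t - f (x (Suc j)) - m j * (t - x (Suc j))" for j t
  define e where "e j = (f (x (Suc (Suc j))) - f (x (Suc j))) - (f (x (Suc j)) - f (x j))" for j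
  \<comment> \<open>An affine function has zero second difference, and the gap at the support point
    itself is 0.\<close>
  have e_eq: "e j = g j (x j) + g j (x (Suc (Suc j)))" for j
    by (simp add: e_def g_def x_Suc algebra_simps)
  have C01: "0 \<le> C k t" "C k t \<le> 1" for k t by (auto simp: C_def)
  have C_mono: "C (Suc j) t \<le> C j t" if "j < n" for j t
  proof -
    have "(t - x (Suc j)) / h \<le> (t - x j) / h" using h(1) by (intro divide_right_mono) (auto simp: x_Suc)
    then show ?thesis using that by (auto simp: C_def clamp01_mono)
  qed
  have supp: "x j \<le> t \<and> t \<le> x (Suc (Suc j))" if j: "j < n" and t: "t \<in> {a..b}" and nz: "p j t \<noteq> 0" for j t
  proof (rule ccontr)
    assume "\<not> ?thesis"
    then consider "t < x j" | "x (Suc (Suc j)) < t" by linarith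
    then have "p j t = 0"
    proof cases
      case 1
      then have "j \<noteq> 0" using t x0 by (metis atLeastAtMost_iff not_less)
      have "(t - x j) / h \<le> 0" "(t - x (Suc j)) / h \<le> 0"
        using 1 h(1) by (auto simp: x_Suc divide_nonpos_pos)
      then show ?thesis using j \<open>j \<noteq> 0\<close> by (simp add: p_def C_def)
    next
      case 2
      then have "Suc j \<noteq> n" using t xn by (metis atLeastAtMost_iff not_less)
      have "1 \<le> (t - x j) / h" "1 \<le> (t - x (Suc j)) / h"
        using 2 h(1) by (auto simp: x_Suc)
      then show ?thesis using j \<open>Suc j \<noteq> n\<close> by (simp add: p_def C_def)
    qed
    with nz show False by simp
  qed
  have g0: "0 \<le> g j t" if "j < n" "t \<in> I" for j t using m [OF that] by (simp add: g_def)
  have xI: "x k \<in> I" if "k \<le> Suc n" for k using sub x_mem that by blast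
  \<comment> \<open>By convexity the gap g grows away from its support point, so its value in a cell
    is at most the one at the outer end of the cell.\<close>
  have chord: "g j (x (Suc j) + u * (y - x (Suc j))) \<le> g j y"
    if "j < n" "y \<in> I" "0 \<le> u" "u \<le> 1" for j y u
  proof -
    have "f ((1 - u) *\<^sub>R x (Suc j) + u *\<^sub>R y) \<le> (1 - u) * f (x (Suc j)) + u * f y"
      using xI [of "Suc j"] that by (intro convex_onD [OF cv]) auto
    moreover have "(1 - u) *\<^sub>R x (Suc j) + u *\<^sub>R y = x (Suc j) + u * (y - x (Suc j))"
      by (simp add: algebra_simps)
    ultimately have "g j (x (Suc j) + u * (y - x (Suc j))) \<le> u * g j y"
      by (simp add: g_def algebra_simps)
    also have "\<dots> \<le> g j y" using that g0 [of j y] by (simp add: mult_left_le_one_le)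
    finally show ?thesis .
  qed
  show ?thesis
  proof (rule that [of n "\<lambda>j. x (Suc j)" m p e])
    show "continuous_on UNIV (p j)" for j
      unfolding p_def C_def using h(1)
      by (cases "j < n"; cases "j = 0"; cases "Suc j = n")
        (auto intro!: continuous_intros continuous_on_clamp01)
    show "0 \<le> p j t" "p j t \<le> 1" for j t
      using C_mono [of j t] C01 [of j t] C01 [of "Suc j" t] by (auto simp: p_def)
    show "(\<Sum>j<n. p j t) = 1" for t
    proof -
      have "(\<Sum>j<n. p j t) = (\<Sum>j<n. C j t - C (Suc j) t)" by (simp add: p_def)
      also have "\<dots> = C 0 t - C n t" by (rule sum_lessThan_telescope')
      finally show ?thesis using n0 by (simp add: C_def)
    qed
    show "\<bar>t - x (Suc j)\<bar> \<le> \<delta> \<and> f t - f (x (Suc j)) - m j * (t - x (Suc j)) \<le> e j"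
      if j: "j < n" and t: "t \<in> {a..b}" "p j t \<noteq> 0" for j t
    proof
      note sp = supp [OF j t]
      then show "\<bar>t - x (Suc j)\<bar> \<le> \<delta>" using hd(2) by (auto simp: x_Suc)
      have "g j t \<le> e j"
      proof (cases "x (Suc j) \<le> t")
        case True
        define u where "u = (t - x (Suc j)) / h"
        have "t = x (Suc j) + u * (x (Suc (Suc j)) - x (Suc j))" using h(1) by (simp add: u_def x_Suc)
        moreover have "0 \<le> u" "u \<le> 1" using True sp h(1) by (auto simp: u_def x_Suc)
        ultimately have "g j t \<le> g j (x (Suc (Suc j)))"
          using chord [OF j xI, of "Suc (Suc j)" u] j by simp
        then show ?thesis using g0 [OF j xI, of j] j by (simp add: e_eq)
      next
        case False
        define u where "u = (x (Suc j) - t) / h"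
        have "t = x (Suc j) + u * (x j - x (Suc j))" using h(1) by (simp add: u_def x_Suc)
        moreover have "0 \<le> u" "u \<le> 1" using False sp h(1) by (auto simp: u_def x_Suc)
        ultimately have "g j t \<le> g j (x j)"
          using chord [OF j xI, of j u] j by simp
        then show ?thesis using g0 [OF j xI, of "Suc (Suc j)"] j by (simp add: e_eq)
      qed
      then show "f t - f (x (Suc j)) - m j * (t - x (Suc j)) \<le> e j" by (simp add: g_def)
    qed
    show "0 \<le> e j" if "j < n" for j
      using g0 [OF that xI, of j] g0 [OF that xI, of "Suc (Suc j)"] that by (simp add: e_eq)
    \<comment> \<open>The telescoped sum is the last increment minus the first, each below
      \<epsilon>/2 in absolute value because h < d.\<close>
    have "(\<Sum>j<n. e j) = (f (x (Suc n)) - f (x n)) - (f (x 1) - f (x 0))"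
      using sum_lessThan_telescope [of "\<lambda>j. f (x (Suc j)) - f (x j)" n] by (simp add: e_def)
    also have "\<dots> \<le> \<epsilon>"
    proof -
      have "\<bar>f (x (Suc k)) - f (x k)\<bar> < \<epsilon> / 2" if "k \<le> n" for k
        using that hd(1) h(1) by (intro d(2) x_mem) (auto simp: x_Suc)
      from this [of n] this [of 0] show ?thesis by (simp only: One_nat_def) linarith
    qed
    finally show "(\<Sum>j<n. e j) \<le> \<epsilon>" .
  qed (use m x_mem in auto)
qed

section \<open>Weak convergence of a strictly convex function\<close>

text \<open>This is the decomposition of n \<phi> into layers of unit height, with truncation to
  [0, n].\<close>

lemma sum_clamp01: "(\<Sum>j<n. clamp01 (y - real j)) = max 0 (min (real n) y)"
  by (induction n) (auto simp: clamp01_def)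

text \<open>The second point ranges over all of I, which may be non-compact. Enlarging [a, b] within
  I to a compact interval that catches every nearby point reduces the claim to uniform continuity
  there.\<close>

lemma uniform_continuity_near_compact_subinterval:
  fixes \<phi> :: "real \<Rightarrow> real"
  assumes I: "is_interval I" and \<phi>: "continuous_on I \<phi>" and ab: "a \<in> I" "b \<in> I" and "0 < \<epsilon>"
  shows "\<exists>r>0. \<forall>s\<in>{a..b}. \<forall>t\<in>I. \<bar>t - s\<bar> < r \<longrightarrow> \<bar>\<phi> t - \<phi> s\<bar> < \<epsilon>"
proof -
  obtain b' d1 where b': "b' \<in> I" "b \<le> b'" "0 < d1" "\<And>t. t \<in> I \<Longrightarrow> t \<le> b + d1 \<Longrightarrow> t \<le> b'"
    using extend_interval_right [OF ab(2)] by blast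
  obtain a' d2 where a': "a' \<in> I" "a' \<le> a" "0 < d2" "\<And>t. t \<in> I \<Longrightarrow> a - d2 \<le> t \<Longrightarrow> a' \<le> t"
    using extend_interval_left [OF ab(1)] by blast
  have "{a'..b'} \<subseteq> I"
    using I a'(1) b'(1) by (meson atLeastAtMost_iff mem_is_interval_1_I subsetI)
  then have "uniformly_continuous_on {a'..b'} \<phi>"
    by (intro compact_uniformly_continuous continuous_on_subset [OF \<phi>]) auto
  then obtain d where d: "0 < d"
      "\<And>s t. s \<in> {a'..b'} \<Longrightarrow> t \<in> {a'..b'} \<Longrightarrow> \<bar>t - s\<bar> < d \<Longrightarrow> \<bar>\<phi> t - \<phi> s\<bar> < \<epsilon>"
    unfolding uniformly_continuous_on_def dist_real_def using \<open>0 < \<epsilon>\<close> by metis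
  define r where "r = min d (min d1 d2)"
  have "\<bar>\<phi> t - \<phi> s\<bar> < \<epsilon>" if "s \<in> {a..b}" "t \<in> I" "\<bar>t - s\<bar> < r" for s t
    using that a'(2) b'(2) a'(4) [of t] b'(4) [of t] by (intro d(2)) (auto simp: r_def)
  moreover have "0 < r" using d(1) a'(3) b'(3) by (simp add: r_def)
  ultimately show ?thesis by blast
qed

text \<open>Only the spectrum of \<open>H0\<close> is confined to a compact interval; those of the
  \<open>H i\<close> may spread over I. Weak convergence enters through quadratic forms.\<close>

context
  fixes I :: "real set" and f :: "real \<Rightarrow> real" and a b :: real
    and F :: "'i filter" and H :: "'i \<Rightarrow> ('a::chilbert_space \<Rightarrow>\<^sub>L 'a)" and H0 :: "'a \<Rightarrow>\<^sub>L 'a"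
  assumes I: "is_interval I" and sc: "strictly_convex_on I f" and cont_f: "continuous_on I f"
    and H: "\<forall>\<^sub>F i in F. H i \<in> selfadjoint_ops \<and> real_spectrum (H i) \<subseteq> I"
    and H0: "H0 \<in> selfadjoint_ops"
    and ab: "a \<in> I" "b \<in> I" "a < b" and H0_ab: "real_spectrum H0 \<subseteq> {a..b}"
    and lim_H: "\<And>y. ((\<lambda>i. y \<bullet> H i y) \<longlongrightarrow> y \<bullet> H0 y) F"
    and lim_f: "\<And>y. ((\<lambda>i. y \<bullet> rfc f (H i) y) \<longlongrightarrow> y \<bullet> rfc f H0 y) F"
begin

lemma H0_I: "real_spectrum H0 \<subseteq> I"
  using I ab H0_ab by (meson atLeastAtMost_iff mem_is_interval_1_I subset_iff)

lemma cont_H0: "continuous_on I g \<Longrightarrow> continuous_on (real_spectrum H0) g"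
  using H0_I continuous_on_subset by blast

text \<open>Split \<open>w = u(H\<^sub>0) x\<close> along a fine partition of unity.  On a piece, the convergence of
  \<open>f(H\<^sub>i)\<close> minus a support line controls \<open>v(H\<^sub>i)\<close> by the error of that line over the cell, and the sum
  of the errors is small.\<close>

lemma separated_product_tendsto_0:
  assumes v: "continuous_on I v" "\<And>t. t \<in> I \<Longrightarrow> \<bar>v t\<bar> \<le> 1" and u: "continuous_on I u" and "0 < r"
    and sep: "\<And>s t. s \<in> real_spectrum H0 \<Longrightarrow> t \<in> I \<Longrightarrow> u s \<noteq> 0 \<Longrightarrow> v t \<noteq> 0 \<Longrightarrow> r \<le> \<bar>t - s\<bar>"
  shows "((\<lambda>i. rfc v (H i) (rfc u H0 x)) \<longlongrightarrow> 0) F"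
proof -
  define w where "w = rfc u H0 x"
  \<comment> \<open>Half of r is spent on the radius of a cell, so that the support of v keeps
    distance r/2 from its grid point.\<close>
  have r2: "0 < r / 2" using \<open>0 < r\<close> by simp
  obtain c where c: "0 < c"
    "\<forall>s\<in>{a..b}. \<forall>m. (\<forall>t\<in>I. f s + m * (t - s) \<le> f t) \<longrightarrow>
      (\<forall>t\<in>I. r / 2 \<le> \<bar>t - s\<bar> \<longrightarrow> c \<le> f t - f s - m * (t - s))"
    using strictly_convex_support_line_gap [OF I sc cont_f ab(1,2) r2] by (elim exE conjE) (rule that)
  have "\<forall>\<^sub>F i in F. norm (rfc v (H i) w) < \<epsilon>" if "0 < \<epsilon>" for \<epsilon>
  proof -
    \<comment> \<open>Chosen so that sqrt(\<epsilon>1 / c) ||w|| < \<epsilon>, also when w =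
      0.\<close>
    define \<epsilon>1 where "\<epsilon>1 = c * \<epsilon>\<^sup>2 / ((norm w)\<^sup>2 + 1)"
    have w1: "0 < (norm w)\<^sup>2 + 1" by (simp add: add_nonneg_pos)
    have \<epsilon>1: "0 < \<epsilon>1" using c(1) that w1 by (simp add: \<epsilon>1_def)
    obtain n :: nat and s m :: "nat \<Rightarrow> real" and p :: "nat \<Rightarrow> real \<Rightarrow> real" and e where
      s: "\<And>j. j < n \<Longrightarrow> s j \<in> {a..b}"
      and m: "\<And>j t. j < n \<Longrightarrow> t \<in> I \<Longrightarrow> f (s j) + m j * (t - s j) \<le> f t"
      and p: "\<And>j. continuous_on UNIV (p j)" "\<And>j t. 0 \<le> p j t" "\<And>j t. p j t \<le> 1"
        "\<And>t. (\<Sum>j<n. p j t) = (1::real)"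
      and cell: "\<And>j t. j < n \<Longrightarrow> t \<in> {a..b} \<Longrightarrow> p j t \<noteq> 0 \<Longrightarrow>
        \<bar>t - s j\<bar> \<le> r / 2 \<and> f t - f (s j) - m j * (t - s j) \<le> e j"
      and e: "\<And>j. j < n \<Longrightarrow> 0 \<le> e j" "(\<Sum>j<n. e j) \<le> \<epsilon>1"
    proof (rule support_line_partition [OF I strictly_convex_imp_convex [OF sc] cont_f ab \<epsilon>1 r2], goal_cases)
      case (1 n s m p e)
      show ?case by (rule that [of n s m p e]; fact 1)
    qed
    define g where "g j t = f t - (f (s j) + m j * (t - s j))" for j t
    have g0: "0 \<le> g j t" if "j < n" "t \<in> I" for j t using m [OF that] by (simp add: g_def)
    have cont_g: "continuous_on I (g j)" for j unfolding g_def by (intro continuous_intros cont_f)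
    have cont_p: "continuous_on K (p j)" for j K using continuous_on_subset [OF p(1)] by blast
    define y where "y j = rfc (p j) H0 w" for j
    have sum_y: "(\<Sum>j<n. y j) = w"
      using rfc_sum [OF H0, of "{..<n}" p w] rfc_const [OF H0, of 1 w] by (simp add: y_def cont_p p(4))
    \<comment> \<open>Since p_j^2 \<le> p_j, each ||y_j||^2 is at most <w, y_j>, and these sum to
      ||w||^2.\<close>
    have norm_y: "(\<Sum>j<n. (norm (y j))\<^sup>2) \<le> (norm w)\<^sup>2"
    proof -
      have "(norm (y j))\<^sup>2 \<le> w \<bullet> y j" for j
      proof -
        have "w \<bullet> rfc (\<lambda>t. (p j t)\<^sup>2) H0 w \<le> w \<bullet> rfc (p j) H0 w"
          by (intro inner_rfc_mono [OF H0] continuous_intros cont_p)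
            (simp add: power2_eq_square mult_left_le p)
        then show ?thesis by (simp add: y_def inner_rfc_square [OF H0 cont_p])
      qed
      then have "(\<Sum>j<n. (norm (y j))\<^sup>2) \<le> (\<Sum>j<n. w \<bullet> y j)" by (intro sum_mono)
      also have "\<dots> = (norm w)\<^sup>2"
        by (simp add: sum_y power2_norm_eq_inner flip: inner_sum_right)
      finally show ?thesis .
    qed
    define q where "q i j = y j \<bullet> rfc (g j) (H i) (y j)" for i j
    define q0 where "q0 j = y j \<bullet> rfc (g j) H0 (y j)" for j
    \<comment> \<open>The affine part of g_j contributes only norms and <y_j, T y_j>, so the form of
      g_j converges along with those of the identity and f.\<close>
    have rfc_g: "y j \<bullet> rfc (g j) T (y j) = y j \<bullet> rfc f T (y j)
        - (f (s j) * (norm (y j))\<^sup>2 + m j * (y j \<bullet> T (y j) - s j * (norm (y j))\<^sup>2))"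
      if T: "T \<in> selfadjoint_ops" and spec: "real_spectrum T \<subseteq> I" for j and T :: "'a \<Rightarrow>\<^sub>L 'a"
    proof -
      have f: "continuous_on (real_spectrum T) f" using continuous_on_subset [OF cont_f spec] .
      have lin: "rfc (\<lambda>t. t - s j) T (y j) = T (y j) - s j *\<^sub>R y j"
        using rfc_diff [OF T continuous_on_id continuous_on_const]
        by (simp add: rfc_const [OF T] rfc_ident [OF T])
      have "rfc (g j) T (y j) = rfc f T (y j) - rfc (\<lambda>t. f (s j) + m j * (t - s j)) T (y j)"
        unfolding g_def by (rule rfc_diff [OF T f]) (intro continuous_intros)
      also have "rfc (\<lambda>t. f (s j) + m j * (t - s j)) T (y j)
          = rfc (\<lambda>_. f (s j)) T (y j) + rfc (\<lambda>t. m j * (t - s j)) T (y j)"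
        by (rule rfc_add [OF T]) (intro continuous_intros)+
      also have "rfc (\<lambda>t. m j * (t - s j)) T (y j) = m j *\<^sub>R rfc (\<lambda>t. t - s j) T (y j)"
        by (rule rfc_cmult [OF T]) (intro continuous_intros)
      finally show ?thesis
        by (simp add: lin rfc_const [OF T] inner_diff_right inner_add_right power2_norm_eq_inner)
    qed
    have lim_q: "((\<lambda>i. q i j) \<longlongrightarrow> q0 j) F" for j
      unfolding q0_def rfc_g [OF H0 H0_I]
    proof (rule Lim_transform_eventually)
      show "\<forall>\<^sub>F i in F. y j \<bullet> rfc f (H i) (y j)
        - (f (s j) * (norm (y j))\<^sup>2 + m j * (y j \<bullet> H i (y j) - s j * (norm (y j))\<^sup>2)) = q i j"
        using H by eventually_elim (simp add: q_def rfc_g)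
    qed (intro tendsto_intros lim_H lim_f)
    \<comment> \<open>On the part of the spectrum where p_j is nonzero, g_j is at most e_j; symmetry
      gathers both factors p_j around g_j.\<close>
    have q0_le: "q0 j \<le> e j * (norm (y j))\<^sup>2" if j: "j < n" for j
    proof -
      have gc: "continuous_on (real_spectrum H0) (g j)" by (rule cont_H0 [OF cont_g])
      have "q0 j = w \<bullet> rfc (\<lambda>t. p j t * (g j t * p j t)) H0 w"
        unfolding q0_def y_def
        by (simp add: rfc_mult [OF H0] gc cont_p continuous_on_mult rfc_symmetric [OF H0 cont_p])
      also have "\<dots> \<le> w \<bullet> rfc (\<lambda>t. e j * (p j t)\<^sup>2) H0 w"
      proof (rule inner_rfc_mono [OF H0])
        fix t assume "t \<in> real_spectrum H0"
        then have "p j t \<noteq> 0 \<Longrightarrow> g j t \<le> e j"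
          using cell [OF j, of t] H0_ab by (auto simp: g_def)
        then have "(p j t)\<^sup>2 * g j t \<le> (p j t)\<^sup>2 * e j"
          by (cases "p j t = 0") (auto intro: mult_left_mono)
        then show "p j t * (g j t * p j t) \<le> e j * (p j t)\<^sup>2"
          by (simp add: power2_eq_square mult_ac)
      qed (intro continuous_intros gc cont_p)+
      also have "\<dots> = e j * (norm (y j))\<^sup>2"
        by (simp add: rfc_cmult [OF H0] inner_rfc_square [OF H0] cont_p y_def continuous_on_power)
      finally show ?thesis .
    qed
    \<comment> \<open>Either p_j u vanishes on the spectrum and y_j = 0, or the cell contains a
      spectral point where u is nonzero. In the second case v vanishes at points of I closer than
      r/2 to s_j, so v^2 \<le> g_j / c.\<close>
    have vy: "norm (rfc v (H i) (y j)) \<le> sqrt (q i j / c)"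
      if j: "j < n" and i: "H i \<in> selfadjoint_ops" "real_spectrum (H i) \<subseteq> I" for i j
    proof (cases "\<exists>s\<in>real_spectrum H0. p j s * u s \<noteq> 0")
      case False
      have "y j = rfc (\<lambda>t. p j t * u t) H0 x"
        by (simp add: y_def w_def rfc_mult [OF H0 cont_p cont_H0 [OF u]])
      also have "\<dots> = rfc (\<lambda>_. 0) H0 x"
        using False by (subst rfc_cong [OF H0]) (auto intro!: continuous_intros cont_p cont_H0 u)
      finally have "y j = 0" by (simp add: rfc_const [OF H0])
      then show ?thesis by (simp add: q_def blinfun.zero_right)
    next
      case True
      then obtain s0 where s0: "s0 \<in> real_spectrum H0" "p j s0 \<noteq> 0" "u s0 \<noteq> 0" by auto
      have gc: "continuous_on (real_spectrum (H i)) (g j)" and vc: "continuous_on (real_spectrum (H i)) v"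
        using continuous_on_subset [OF _ i(2)] cont_g v(1) by blast+
      have le: "(v t)\<^sup>2 \<le> 1 / c * g j t" if t: "t \<in> I" for t
      proof (cases "v t = 0")
        case True
        then show ?thesis using g0 [OF j t] c(1) by simp
      next
        case False
        have "r \<le> \<bar>t - s0\<bar>" using sep [OF s0(1) t s0(3) False] .
        moreover have "\<bar>s0 - s j\<bar> \<le> r / 2" using cell [OF j _ s0(2)] s0(1) H0_ab by auto
        ultimately have "r / 2 \<le> \<bar>t - s j\<bar>" by linarith
        then have "c \<le> g j t"
          using c(2) [rule_format, OF s [OF j] m [OF j] t] by (simp add: g_def)
        then have "1 \<le> 1 / c * g j t" using c(1) by (simp add: field_simps)
        moreover have "(v t)\<^sup>2 \<le> 1" using v(2) [OF t] by (simp add: abs_square_le_1)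
        ultimately show ?thesis by linarith
      qed
      have "(norm (rfc v (H i) (y j)))\<^sup>2 = y j \<bullet> rfc (\<lambda>t. (v t)\<^sup>2) (H i) (y j)"
        by (simp add: inner_rfc_square [OF i(1) vc])
      also have "\<dots> \<le> y j \<bullet> rfc (\<lambda>t. 1 / c * g j t) (H i) (y j)"
        by (intro inner_rfc_mono [OF i(1)] continuous_on_power continuous_on_mult_left vc gc le) (use i(2) in blast)
      also have "\<dots> = q i j / c"
        unfolding rfc_cmult [OF i(1) gc] by (simp add: q_def)
      finally show ?thesis by (simp add: real_le_rsqrt)
    qed
    define B where "B i = (\<Sum>j<n. sqrt (q i j / c))" for i
    have le_B: "\<forall>\<^sub>F i in F. norm (rfc v (H i) w) \<le> B i"
      using H
    proof eventually_elim
      case (elim i)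
      have "rfc v (H i) w = (\<Sum>j<n. rfc v (H i) (y j))"
        by (simp add: sum_y flip: blinfun.sum_right)
      also have "norm \<dots> \<le> (\<Sum>j<n. norm (rfc v (H i) (y j)))" by (rule norm_sum)
      also have "\<dots> \<le> B i" unfolding B_def using vy elim by (intro sum_mono) auto
      finally show ?case .
    qed
    have lim_B: "(B \<longlongrightarrow> (\<Sum>j<n. sqrt (q0 j / c))) F"
      unfolding B_def using c(1) by (intro tendsto_intros lim_q) auto
    have "(\<Sum>j<n. sqrt (q0 j / c)) \<le> (\<Sum>j<n. \<bar>sqrt (e j / c)\<bar> * \<bar>norm (y j)\<bar>)"
    proof (rule sum_mono)
      fix j assume "j \<in> {..<n}"
      then have j: "j < n" by simp
      have "q0 j / c \<le> e j / c * (norm (y j))\<^sup>2" using q0_le [OF j] c(1) by (simp add: field_simps)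
      then have "sqrt (q0 j / c) \<le> sqrt (e j / c * (norm (y j))\<^sup>2)" by (rule real_sqrt_le_mono)
      also have "\<dots> = \<bar>sqrt (e j / c)\<bar> * \<bar>norm (y j)\<bar>" 
        using e(1) [OF j] c(1) by (simp only: real_sqrt_mult real_sqrt_abs) simp
      finally show "sqrt (q0 j / c) \<le> \<bar>sqrt (e j / c)\<bar> * \<bar>norm (y j)\<bar>" .
    qed
    \<comment> \<open>Cauchy-Schwarz separates the errors e_j from the norms ||y_j||, so the bound
      does not grow with the number of cells.\<close>
    also have "\<dots> \<le> L2_set (\<lambda>j. sqrt (e j / c)) {..<n} * L2_set (\<lambda>j. norm (y j)) {..<n}"
      by (rule L2_set_mult_ineq)
    also have "L2_set (\<lambda>j. sqrt (e j / c)) {..<n} = sqrt ((\<Sum>j<n. e j) / c)"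
      using e(1) c(1) unfolding L2_set_def by (simp add: sum_divide_distrib)
    also have "sqrt ((\<Sum>j<n. e j) / c) * L2_set (\<lambda>j. norm (y j)) {..<n} \<le> sqrt (\<epsilon>1 / c) * norm w"
    proof (rule mult_mono)
      show "sqrt ((\<Sum>j<n. e j) / c) \<le> sqrt (\<epsilon>1 / c)"
        using e(2) c(1) by (simp add: divide_right_mono)
      show "L2_set (\<lambda>j. norm (y j)) {..<n} \<le> norm w"
        unfolding L2_set_def using norm_y by (simp add: real_le_lsqrt)
    qed (use \<epsilon>1 c(1) in \<open>auto simp: L2_set_nonneg\<close>)
    also have "\<dots> < \<epsilon>"
    proof (rule power2_less_imp_less)
      have "(sqrt (\<epsilon>1 / c) * norm w)\<^sup>2 = \<epsilon>1 / c * (norm w)\<^sup>2"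
        using \<epsilon>1 c(1) by (simp add: power_mult_distrib)
      also have "\<dots> = \<epsilon>\<^sup>2 * ((norm w)\<^sup>2 / ((norm w)\<^sup>2 + 1))"
        using c(1) by (simp add: \<epsilon>1_def)
      also have "\<dots> < \<epsilon>\<^sup>2 * 1"
        using w1 that by (intro mult_strict_left_mono) (simp_all add: pos_divide_less_eq)
      finally show "(sqrt (\<epsilon>1 / c) * norm w)\<^sup>2 < \<epsilon>\<^sup>2" by simp
    qed (use that in simp)
    finally have "\<forall>\<^sub>F i in F. B i < \<epsilon>" by (rule order_tendstoD(2) [OF lim_B])
    with le_B show ?thesis by eventually_elim simp
  qed
  then show ?thesis unfolding w_def tendsto_iff by simp
qed

text \<open>For the layers \<open>A = \<alpha>\<^sub>j(H\<^sub>i)\<close> and \<open>B = \<beta>\<^sub>j(H\<^sub>0)\<close> of \<open>n\<phi>\<close>, shifted by two so that \<open>\<alpha>\<^sub>j\<close> and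
  \<open>1 - \<beta>\<^sub>j\<close> have separated supports, \<open>A (1 - B)\<close> tends to \<open>0\<close> and hence \<open>A\<close> is asymptotically at most
  \<open>B\<^sup>2 \<le> B\<close>.\<close>

lemma weak_upper_bound:
  assumes \<phi>: "continuous_on I \<phi>" "\<And>t. t \<in> I \<Longrightarrow> 0 \<le> \<phi> t" "\<And>t. t \<in> I \<Longrightarrow> \<phi> t \<le> 1" and "0 < \<eta>"
  shows "\<forall>\<^sub>F i in F. x \<bullet> rfc \<phi> (H i) x < x \<bullet> rfc \<phi> H0 x + \<eta>"
proof -
  \<comment> \<open>The shift by two layers costs 2 ||x||^2 / n, which must stay below
    \<eta>.\<close>
  obtain n where n: "2 * (norm x)\<^sup>2 / \<eta> < real n"
    using reals_Archimedean2 by blast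
  have "0 \<le> 2 * (norm x)\<^sup>2 / \<eta>" using \<open>0 < \<eta>\<close> by simp
  then have n0: "0 < real n" using n by linarith
  then have "0 < 1 / real n" by simp
  obtain r where r: "0 < r" "\<forall>s\<in>{a..b}. \<forall>t\<in>I. \<bar>t - s\<bar> < r \<longrightarrow> \<bar>\<phi> t - \<phi> s\<bar> < 1 / real n"
    using uniform_continuity_near_compact_subinterval [OF I \<phi>(1) ab(1,2) \<open>0 < 1 / real n\<close>]
    by (elim exE conjE) (rule that)
  define \<alpha> where "\<alpha> j t = clamp01 (real n * \<phi> t - 2 - real j)" for j t
  define \<beta> where "\<beta> j t = clamp01 (real n * \<phi> t - real j)" for j t
  define u where "u j t = 1 - \<beta> j t" for j t
  have cont: "continuous_on I (\<alpha> j)" "continuous_on I (\<beta> j)" "continuous_on I (u j)" for j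
    unfolding u_def \<alpha>_def \<beta>_def by (intro continuous_intros continuous_on_clamp01 \<phi>(1))+
  define z where "z j = rfc (u j) H0 x" for j
  define y where "y j = rfc (\<beta> j) H0 x" for j
  define A where "A i j = rfc (\<alpha> j) (H i)" for i j
  have x_eq: "x = y j + z j" for j
    unfolding y_def z_def u_def
    by (subst rfc_diff [OF H0]) (auto intro!: cont_H0 cont continuous_intros simp: rfc_const [OF H0])
  have sep: "((\<lambda>i. A i j (z j)) \<longlongrightarrow> 0) F" for j
    unfolding A_def z_def
  proof (rule separated_product_tendsto_0 [OF cont(1) _ cont(3) r(1)])
    show "\<bar>\<alpha> j t\<bar> \<le> 1" for t by (simp add: \<alpha>_def)
    fix s t assume s: "s \<in> real_spectrum H0" and t: "t \<in> I" and nz: "u j s \<noteq> 0" "\<alpha> j t \<noteq> 0"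
    have "real n * \<phi> s - real j < 1" using nz(1) by (auto simp: u_def \<beta>_def intro: ccontr)
    moreover have "0 < real n * \<phi> t - 2 - real j" using nz(2) by (auto simp: \<alpha>_def intro: ccontr)
    ultimately have "1 < real n * (\<phi> t - \<phi> s)" by (simp add: algebra_simps)
    then have "1 / real n < \<phi> t - \<phi> s" using n0 by (simp add: field_simps)
    then show "r \<le> \<bar>t - s\<bar>" using r(2) s t H0_ab by (meson abs_ge_self less_asym' less_le_trans not_le subsetD)
  qed
  \<comment> \<open>Expand <x, A x> along x = y_j + z_j and use <y_j, A y_j> \<le> ||y_j||^2 \<le>
    <x, y_j>; the terms containing A z_j tend to 0.\<close>
  define R where "R i j = x \<bullet> y j + (2 * (y j \<bullet> A i j (z j)) + z j \<bullet> A i j (z j))" for i j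
  have lim_R: "((\<lambda>i. R i j) \<longlongrightarrow> x \<bullet> y j) F" for j
  proof -
    have "((\<lambda>i. R i j) \<longlongrightarrow> x \<bullet> y j + (2 * (y j \<bullet> 0) + z j \<bullet> 0)) F"
      unfolding R_def by (intro tendsto_intros sep)
    then show ?thesis by simp
  qed
  have norm_y: "(norm (y j))\<^sup>2 \<le> x \<bullet> y j" for j
  proof -
    have "x \<bullet> rfc (\<lambda>t. (\<beta> j t)\<^sup>2) H0 x \<le> x \<bullet> rfc (\<beta> j) H0 x"
      by (intro inner_rfc_mono [OF H0] continuous_on_power cont_H0 cont)
        (simp add: \<beta>_def power2_eq_square mult_left_le)
    then show ?thesis by (simp add: y_def inner_rfc_square [OF H0 cont_H0 [OF cont(2)]])
  qed
  have bound: "real n * (x \<bullet> rfc \<phi> (H i) x) \<le> (\<Sum>j<n. R i j) + 2 * (norm x)\<^sup>2"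
    if i: "H i \<in> selfadjoint_ops" "real_spectrum (H i) \<subseteq> I" for i
  proof -
    have sub: "continuous_on (real_spectrum (H i)) g" if "continuous_on I g" for g :: "real \<Rightarrow> real"
      using continuous_on_subset [OF that i(2)] .
    have "x \<bullet> A i j x \<le> R i j" for j
    proof -
      have "y j \<bullet> A i j (y j) \<le> y j \<bullet> rfc (\<lambda>_. 1) (H i) (y j)"
        unfolding A_def by (intro inner_rfc_mono [OF i(1)] sub cont continuous_intros) (simp add: \<alpha>_def)
      also have "\<dots> \<le> x \<bullet> y j"
        using norm_y [of j] by (simp add: rfc_const [OF i(1)] power2_norm_eq_inner)
      finally have "y j \<bullet> A i j (y j) \<le> x \<bullet> y j" .
      moreover have "z j \<bullet> A i j (y j) = y j \<bullet> A i j (z j)"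
        unfolding A_def by (metis inner_commute rfc_symmetric [OF i(1) sub [OF cont(1)]])
      moreover have "x \<bullet> A i j x = (y j + z j) \<bullet> A i j (y j + z j)"
        by (simp flip: x_eq)
      ultimately show ?thesis
        by (simp add: R_def blinfun.add_right inner_add_left inner_add_right)
    qed
    then have "(\<Sum>j<n. x \<bullet> A i j x) \<le> (\<Sum>j<n. R i j)" by (intro sum_mono)
    moreover have "(\<Sum>j<n. x \<bullet> A i j x) = x \<bullet> rfc (\<lambda>t. \<Sum>j<n. \<alpha> j t) (H i) x"
      unfolding A_def by (subst rfc_sum [OF i(1)]) (auto intro: sub cont simp: inner_sum_right)
    moreover have "x \<bullet> rfc (\<lambda>t. real n * \<phi> t - 2) (H i) x \<le> x \<bullet> rfc (\<lambda>t. \<Sum>j<n. \<alpha> j t) (H i) x"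
    proof (intro inner_rfc_mono [OF i(1)] sub continuous_intros cont \<phi>(1))
      fix t assume "t \<in> real_spectrum (H i)"
      then have "\<phi> t \<le> 1" using \<phi>(3) i(2) by blast
      then have "real n * \<phi> t \<le> real n" using n0 by (simp add: mult_left_le)
      \<comment> \<open>The layers sum to n \<phi> - 2 truncated to [0, n]; since \<phi> \<le> 1,
        only the truncation at 0 can take effect.\<close>
      then show "real n * \<phi> t - 2 \<le> (\<Sum>j<n. \<alpha> j t)" by (simp add: \<alpha>_def sum_clamp01)
    qed
    moreover have "x \<bullet> rfc (\<lambda>t. real n * \<phi> t - 2) (H i) x = real n * (x \<bullet> rfc \<phi> (H i) x) - 2 * (norm x)\<^sup>2"
      by (subst rfc_diff [OF i(1)])
        (auto intro!: continuous_intros sub \<phi>(1)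
          simp: rfc_const [OF i(1)] rfc_cmult [OF i(1) sub [OF \<phi>(1)]] inner_diff_right power2_norm_eq_inner)
    ultimately show ?thesis by linarith
  qed
  have "(\<Sum>j<n. x \<bullet> y j) = x \<bullet> rfc (\<lambda>t. \<Sum>j<n. \<beta> j t) H0 x"
    unfolding y_def by (subst rfc_sum [OF H0]) (auto intro: cont_H0 cont simp: inner_sum_right)
  \<comment> \<open>The unshifted layers lose nothing, since 0 \<le> n \<phi> \<le> n on the
    spectrum of \<open>H0\<close>.\<close>
  also have "rfc (\<lambda>t. \<Sum>j<n. \<beta> j t) H0 = rfc (\<lambda>t. real n * \<phi> t) H0"
  proof (rule rfc_cong [OF H0])
    fix t assume "t \<in> real_spectrum H0"
    then have "0 \<le> \<phi> t" "\<phi> t \<le> 1" using \<phi>(2,3) H0_I by blast+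
    then have "0 \<le> real n * \<phi> t" "real n * \<phi> t \<le> real n" using n0 by (simp_all add: mult_left_le)
    then show "(\<Sum>j<n. \<beta> j t) = real n * \<phi> t" by (simp add: \<beta>_def sum_clamp01)
  qed (intro continuous_intros cont_H0 cont)
  finally have sum_y: "(\<Sum>j<n. x \<bullet> y j) = real n * (x \<bullet> rfc \<phi> H0 x)"
    by (simp add: rfc_cmult [OF H0 cont_H0 [OF \<phi>(1)]])
  have "((\<lambda>i. (\<Sum>j<n. R i j) + 2 * (norm x)\<^sup>2) \<longlongrightarrow> (\<Sum>j<n. x \<bullet> y j) + 2 * (norm x)\<^sup>2) F"
    by (intro tendsto_intros lim_R)
  moreover have "(\<Sum>j<n. x \<bullet> y j) + 2 * (norm x)\<^sup>2 < real n * (x \<bullet> rfc \<phi> H0 x + \<eta>)"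
    using n \<open>0 < \<eta>\<close> by (simp add: sum_y pos_divide_less_eq distrib_left)
  ultimately have "\<forall>\<^sub>F i in F. (\<Sum>j<n. R i j) + 2 * (norm x)\<^sup>2 < real n * (x \<bullet> rfc \<phi> H0 x + \<eta>)"
    by (rule order_tendstoD(2))
  with H show ?thesis
  proof eventually_elim
    case (elim i)
    then have "real n * (x \<bullet> rfc \<phi> (H i) x) < real n * (x \<bullet> rfc \<phi> H0 x + \<eta>)"
      using bound [of i] by linarith
    then show ?case using n0 by simp
  qed
qed

text \<open>Applying the upper bound to 1 - \<phi> as well gives the matching lower bound.\<close>

lemma weak_convergence_unit:
  assumes \<phi>: "continuous_on I \<phi>" "\<And>t. t \<in> I \<Longrightarrow> 0 \<le> \<phi> t" "\<And>t. t \<in> I \<Longrightarrow> \<phi> t \<le> 1"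
  shows "((\<lambda>i. x \<bullet> rfc \<phi> (H i) x) \<longlongrightarrow> x \<bullet> rfc \<phi> H0 x) F"
proof (rule tendstoI)
  fix \<eta> :: real assume \<eta>: "0 < \<eta>"
  have compl: "x \<bullet> rfc (\<lambda>t. 1 - \<phi> t) T x = x \<bullet> x - x \<bullet> rfc \<phi> T x"
    if "T \<in> selfadjoint_ops" "real_spectrum T \<subseteq> I" for T :: "'a \<Rightarrow>\<^sub>L 'a"
    using that continuous_on_subset [OF \<phi>(1) that(2)]
    by (subst rfc_diff) (auto intro: continuous_intros simp: rfc_const inner_diff_right)
  have upper: "\<forall>\<^sub>F i in F. x \<bullet> rfc \<phi> (H i) x < x \<bullet> rfc \<phi> H0 x + \<eta>"
    by (rule weak_upper_bound) (use \<phi> \<eta> in auto)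
  have "\<forall>\<^sub>F i in F. x \<bullet> rfc (\<lambda>t. 1 - \<phi> t) (H i) x < x \<bullet> rfc (\<lambda>t. 1 - \<phi> t) H0 x + \<eta>"
    using \<phi> \<eta> by (intro weak_upper_bound continuous_intros) auto
  with upper H
  show "\<forall>\<^sub>F i in F. dist (x \<bullet> rfc \<phi> (H i) x) (x \<bullet> rfc \<phi> H0 x) < \<eta>"
  proof eventually_elim
    case (elim i)
    then show ?case using compl [of "H i"] compl [OF H0 H0_I] by (auto simp: dist_real_def)
  qed
qed

section \<open>From weak convergence for values in [0, 1] to strong convergence for bounded
  functions\<close>

lemma weak_convergence:
  assumes \<phi>: "continuous_on I \<phi>" and M: "\<And>t. t \<in> I \<Longrightarrow> \<bar>\<phi> t\<bar> \<le> M"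
  shows "((\<lambda>i. x \<bullet> rfc \<phi> (H i) x) \<longlongrightarrow> x \<bullet> rfc \<phi> H0 x) F"
proof -
  \<comment> \<open>Positive whatever the sign of \<open>M\<close>, so that \<phi> can be rescaled
    affinely into [0, 1].\<close>
  define K where "K = \<bar>M\<bar> + 1"
  define \<psi> where "\<psi> t = (\<phi> t + K) / (2 * K)" for t
  have K: "0 < K" by (simp add: K_def)
  have \<psi>: "continuous_on I \<psi>" unfolding \<psi>_def using K by (intro continuous_intros \<phi>) auto
  have "0 \<le> \<psi> t \<and> \<psi> t \<le> 1" if "t \<in> I" for t
    using M [OF that] K by (auto simp: \<psi>_def K_def field_simps)
  then have "((\<lambda>i. x \<bullet> rfc \<psi> (H i) x) \<longlongrightarrow> x \<bullet> rfc \<psi> H0 x) F"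
    by (intro weak_convergence_unit \<psi>) auto
  then have lim: "((\<lambda>i. 2 * K * (x \<bullet> rfc \<psi> (H i) x) - K * (x \<bullet> x))
      \<longlongrightarrow> 2 * K * (x \<bullet> rfc \<psi> H0 x) - K * (x \<bullet> x)) F"
    by (intro tendsto_diff tendsto_mult_left tendsto_const)
  have eq: "x \<bullet> rfc \<phi> T x = 2 * K * (x \<bullet> rfc \<psi> T x) - K * (x \<bullet> x)"
    if T: "T \<in> selfadjoint_ops" and spec: "real_spectrum T \<subseteq> I" for T :: "'a \<Rightarrow>\<^sub>L 'a"
  proof -
    have c: "continuous_on (real_spectrum T) \<psi>" using continuous_on_subset [OF \<psi> spec] .
    have "\<phi> = (\<lambda>t. 2 * K * \<psi> t - K)" using K by (auto simp: \<psi>_def)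
    then have "rfc \<phi> T x = rfc (\<lambda>t. 2 * K * \<psi> t - K) T x" by simp
    also have "\<dots> = (2 * K) *\<^sub>R rfc \<psi> T x - K *\<^sub>R x"
      by (subst rfc_diff [OF T]) (auto intro!: continuous_intros c simp: rfc_const [OF T] rfc_cmult [OF T c])
    finally show ?thesis by (simp add: inner_diff_right)
  qed
  have "\<forall>\<^sub>F i in F. 2 * K * (x \<bullet> rfc \<psi> (H i) x) - K * (x \<bullet> x) = x \<bullet> rfc \<phi> (H i) x"
    using H by eventually_elim (simp add: eq)
  then show ?thesis
    unfolding eq [OF H0 H0_I] by (rule Lim_transform_eventually [OF lim])
qed

text \<open>Expand ||\<phi>(H_i) x - y||^2 = <x, \<phi>^2(H_i) x> - 2 <x, \<phi>(H_i) y> + ||y||^2.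
  Weak convergence applies to \<phi>^2, and polarisation supplies the mixed term; the limit is 0
  because y = \<phi>(H0) x.\<close>

lemma strong_convergence_real:
  assumes \<phi>: "continuous_on I \<phi>" and M: "\<And>t. t \<in> I \<Longrightarrow> \<bar>\<phi> t\<bar> \<le> M"
  shows "((\<lambda>i. rfc \<phi> (H i) x) \<longlongrightarrow> rfc \<phi> H0 x) F"
proof -
  define y where "y = rfc \<phi> H0 x"
  have polar: "x \<bullet> rfc \<phi> T y = ((x + y) \<bullet> rfc \<phi> T (x + y) - (x - y) \<bullet> rfc \<phi> T (x - y)) / 4"
    if "T \<in> selfadjoint_ops" "real_spectrum T \<subseteq> I" for T :: "'a \<Rightarrow>\<^sub>L 'a"
    using rfc_symmetric [OF that(1) continuous_on_subset [OF \<phi> that(2)], of y x]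
    by (simp add: blinfun.add_right blinfun.diff_right inner_add_left inner_add_right
        inner_diff_left inner_diff_right inner_commute)
  have "((\<lambda>i. ((x + y) \<bullet> rfc \<phi> (H i) (x + y) - (x - y) \<bullet> rfc \<phi> (H i) (x - y)) / 4)
      \<longlongrightarrow> ((x + y) \<bullet> rfc \<phi> H0 (x + y) - (x - y) \<bullet> rfc \<phi> H0 (x - y)) / 4) F"
    by (intro tendsto_divide tendsto_diff tendsto_const weak_convergence [OF \<phi> M]) auto
  moreover have "((\<lambda>i. x \<bullet> rfc (\<lambda>t. (\<phi> t)\<^sup>2) (H i) x) \<longlongrightarrow> x \<bullet> rfc (\<lambda>t. (\<phi> t)\<^sup>2) H0 x) F"
  proof (rule weak_convergence)
    show "\<bar>(\<phi> t)\<^sup>2\<bar> \<le> M\<^sup>2" if "t \<in> I" for t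
      using power_mono [OF M [OF that], of 2] by simp
  qed (intro continuous_intros \<phi>)
  ultimately have "((\<lambda>i. x \<bullet> rfc (\<lambda>t. (\<phi> t)\<^sup>2) (H i) x
      - 2 * (((x + y) \<bullet> rfc \<phi> (H i) (x + y) - (x - y) \<bullet> rfc \<phi> (H i) (x - y)) / 4) + y \<bullet> y)
    \<longlongrightarrow> x \<bullet> rfc (\<lambda>t. (\<phi> t)\<^sup>2) H0 x
      - 2 * (((x + y) \<bullet> rfc \<phi> H0 (x + y) - (x - y) \<bullet> rfc \<phi> H0 (x - y)) / 4) + y \<bullet> y) F"
    by (intro tendsto_add tendsto_diff tendsto_mult_left tendsto_const)
  also have "x \<bullet> rfc (\<lambda>t. (\<phi> t)\<^sup>2) H0 x
      - 2 * (((x + y) \<bullet> rfc \<phi> H0 (x + y) - (x - y) \<bullet> rfc \<phi> H0 (x - y)) / 4) + y \<bullet> y = 0"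
    using inner_rfc_square [OF H0 cont_H0 [OF \<phi>], of x] rfc_symmetric [OF H0 cont_H0 [OF \<phi>], of x y]
    by (simp add: y_def power2_norm_eq_inner flip: polar [OF H0 H0_I, unfolded y_def])
  finally have lim: "((\<lambda>i. x \<bullet> rfc (\<lambda>t. (\<phi> t)\<^sup>2) (H i) x
      - 2 * (((x + y) \<bullet> rfc \<phi> (H i) (x + y) - (x - y) \<bullet> rfc \<phi> (H i) (x - y)) / 4) + y \<bullet> y) \<longlongrightarrow> 0) F" .
  have "((\<lambda>i. (norm (rfc \<phi> (H i) x - y))\<^sup>2) \<longlongrightarrow> 0) F"
  proof (rule Lim_transform_eventually [OF lim])
    show "\<forall>\<^sub>F i in F. x \<bullet> rfc (\<lambda>t. (\<phi> t)\<^sup>2) (H i) x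
      - 2 * (((x + y) \<bullet> rfc \<phi> (H i) (x + y) - (x - y) \<bullet> rfc \<phi> (H i) (x - y)) / 4) + y \<bullet> y
      = (norm (rfc \<phi> (H i) x - y))\<^sup>2"
      using H
    proof eventually_elim
      case (elim i)
      have c: "continuous_on (real_spectrum (H i)) \<phi>"
        using elim continuous_on_subset [OF \<phi>] by blast
      have "(norm (rfc \<phi> (H i) x - y))\<^sup>2 = (norm (rfc \<phi> (H i) x))\<^sup>2 - 2 * (x \<bullet> rfc \<phi> (H i) y) + y \<bullet> y"
        using rfc_symmetric [OF conjunct1 [OF elim] c, of x y]
        by (simp add: power2_norm_eq_inner inner_diff_left inner_diff_right inner_commute)
      then show ?case
        using polar [of "H i"] elim inner_rfc_square [OF conjunct1 [OF elim] c, of x] by simp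
    qed
  qed
  then have "((\<lambda>i. sqrt ((norm (rfc \<phi> (H i) x - y))\<^sup>2)) \<longlongrightarrow> sqrt 0) F"
    by (rule tendsto_real_sqrt)
  then have "((\<lambda>i. norm (rfc \<phi> (H i) x - y)) \<longlongrightarrow> 0) F" by simp
  then show ?thesis
    unfolding y_def by (rule LIM_zero_cancel [OF tendsto_norm_zero_cancel])
qed

lemma strong_convergence:
  fixes \<phi> :: "real \<Rightarrow> complex"
  assumes \<phi>: "continuous_on I \<phi>" and "bounded (\<phi> ` I)"
  shows "((\<lambda>i. cfc \<phi> (H i) x) \<longlongrightarrow> cfc \<phi> H0 x) F"
proof -
  obtain M where M: "\<And>t. t \<in> I \<Longrightarrow> cmod (\<phi> t) \<le> M"
    using assms(2) unfolding bounded_iff by blast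
  have re: "((\<lambda>i. rfc (\<lambda>t. Re (\<phi> t)) (H i) x) \<longlongrightarrow> rfc (\<lambda>t. Re (\<phi> t)) H0 x) F"
    using M abs_Re_le_cmod by (intro strong_convergence_real continuous_intros \<phi>) (blast intro: order_trans)
  have im: "((\<lambda>i. rfc (\<lambda>t. Im (\<phi> t)) (H i) x) \<longlongrightarrow> rfc (\<lambda>t. Im (\<phi> t)) H0 x) F"
    using M abs_Im_le_cmod by (intro strong_convergence_real continuous_intros \<phi>) (blast intro: order_trans)
  have "((\<lambda>i. rfc (\<lambda>t. Re (\<phi> t)) (H i) x + scale_op \<i> (rfc (\<lambda>t. Im (\<phi> t)) (H i) x))
      \<longlongrightarrow> rfc (\<lambda>t. Re (\<phi> t)) H0 x + scale_op \<i> (rfc (\<lambda>t. Im (\<phi> t)) H0 x)) F"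
    by (intro tendsto_intros re im)
  then have lim: "((\<lambda>i. rfc (\<lambda>t. Re (\<phi> t)) (H i) x + \<i> *\<^sub>C rfc (\<lambda>t. Im (\<phi> t)) (H i) x)
      \<longlongrightarrow> cfc \<phi> H0 x) F"
    using cfc_Re_Im [OF H0 continuous_on_subset [OF \<phi> H0_I]] by simp
  have "\<forall>\<^sub>F i in F. rfc (\<lambda>t. Re (\<phi> t)) (H i) x + \<i> *\<^sub>C rfc (\<lambda>t. Im (\<phi> t)) (H i) x = cfc \<phi> (H i) x"
    using H
  proof eventually_elim
    case (elim i)
    then show ?case using cfc_Re_Im [of "H i"] continuous_on_subset [OF \<phi>] by simp
  qed
  with lim show ?thesis by (rule Lim_transform_eventually)
qed

end

section \<open>Degenerate cases and the assembly of the theorem\<close>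

lemma cfc_eq_const:
  assumes T: "T \<in> selfadjoint_ops" and \<phi>: "\<And>t. t \<in> real_spectrum T \<Longrightarrow> \<phi> t = k"
  shows "cfc \<phi> T x = k *\<^sub>C x"
proof -
  have "continuous_on (real_spectrum T) \<phi>"
    using \<phi> by (intro continuous_on_eq [OF continuous_on_const [of _ k]]) simp
  then have "cfc \<phi> T = cfc (\<lambda>_. k * 1) T"
    using \<phi> by (intro is_cfcD(2) [OF is_cfc_cfc [OF T]]) auto
  then show ?thesis
    using is_cfcD(4) [OF is_cfc_cfc [OF T], of "\<lambda>_. 1" k x] is_cfcD(7) [OF is_cfc_cfc [OF T]] by simp
qed

lemma cfc_eq_self:
  assumes T: "T \<in> selfadjoint_ops" and \<phi>: "\<And>t. t \<in> real_spectrum T \<Longrightarrow> \<phi> t = complex_of_real t"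
  shows "cfc \<phi> T = T"
proof -
  have id: "continuous_on (real_spectrum T) complex_of_real"
    by (intro continuous_on_of_real_id)
  then have "continuous_on (real_spectrum T) \<phi>"
    using \<phi> by (intro continuous_on_eq [OF id]) simp
  then have "cfc \<phi> T = cfc complex_of_real T"
    using \<phi> id by (intro is_cfcD(2) [OF is_cfc_cfc [OF T]]) auto
  then show ?thesis by (simp add: is_cfcD(8) [OF is_cfc_cfc [OF T]])
qed

lemma weak_limit_inner:
  assumes "limitin weak_operator_topology A B F"
  shows "((\<lambda>i. x \<bullet> blinfun_apply (A i) y) \<longlongrightarrow> x \<bullet> blinfun_apply B y) F"
  using assms unfolding limitin_weak_operator_topology_iff Re_cinner [symmetric]
  by (intro tendsto_Re) simp

text \<open>Both sides of the symmetry identity are limits of the same real family, so they agree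
  because the filter is proper.\<close>

lemma selfadjoint_weak_limit:
  assumes "F \<noteq> bot" "\<forall>\<^sub>F i in F. H i \<in> selfadjoint_ops" "H0 \<in> bounded_ops"
    and lim: "limitin weak_operator_topology H H0 F"
  shows "H0 \<in> selfadjoint_ops"
proof -
  note lim' = weak_limit_inner [OF lim]
  have "H0 x \<bullet> y = x \<bullet> H0 y" for x y
  proof (rule tendsto_unique [OF assms(1)])
    show "((\<lambda>i. y \<bullet> H i x) \<longlongrightarrow> H0 x \<bullet> y) F"
      using lim' [of y x] by (simp add: inner_commute)
    have "\<forall>\<^sub>F i in F. x \<bullet> H i y = y \<bullet> H i x"
      using assms(2)
    proof eventually_elim
      case (elim i)
      then show ?case
        using is_adjointD [of "H i" "H i" x y] by (simp add: selfadjoint_ops_def inner_commute)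
    qed
    then show "((\<lambda>i. y \<bullet> H i x) \<longlongrightarrow> x \<bullet> H0 y) F"
      by (rule Lim_transform_eventually [OF lim'])
  qed
  then show ?thesis
    using assms(3) by (simp add: selfadjoint_ops_def is_adjoint_bounded_ops_iff)
qed

theorem theorem2p1:
  fixes I :: "real set"
    and f :: "real \<Rightarrow> real"
    and D :: "'i set"
    and le :: "'i \<Rightarrow> 'i \<Rightarrow> bool"
    and H :: "'i \<Rightarrow> ('a::chilbert_space \<Rightarrow>\<^sub>L 'a)"
    and H0 :: "'a \<Rightarrow>\<^sub>L 'a"
  assumes "is_interval I"
    and "strictly_convex_on I f"
    and "continuous_on I f"
    and "directed_set D le"
    and "\<And>i. i \<in> D \<Longrightarrow> H i \<in> selfadjoint_ops"
    and "\<And>i. i \<in> D \<Longrightarrow> spectrum (H i) \<subseteq> complex_of_real ` I"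
    and "H0 \<in> bounded_ops"
    and "spectrum H0 \<subseteq> complex_of_real ` I"
    and "limitin weak_operator_topology H H0 (net_filter D le)"
    and "limitin weak_operator_topology
           (\<lambda>i. cfc (\<lambda>t. complex_of_real (f t)) (H i))
           (cfc (\<lambda>t. complex_of_real (f t)) H0) (net_filter D le)"
  shows "(\<forall>\<phi>::real \<Rightarrow> complex. continuous_on I \<phi> \<longrightarrow> bounded (\<phi> ` I) \<longrightarrow>
            limitin strong_operator_topology (\<lambda>i. cfc \<phi> (H i)) (cfc \<phi> H0) (net_filter D le))
       \<and> (bounded (H ` D) \<longrightarrow> limitin strong_operator_topology H H0 (net_filter D le))"
proof -
  define F where "F = net_filter D le"
  have in_D: "\<forall>\<^sub>F i in F. i \<in> D"
    using assms(4) unfolding F_def eventually_net_filter [OF assms(4)] directed_set_def by blast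
  have "F \<noteq> bot"
    using assms(4) unfolding F_def eventually_False [symmetric] eventually_net_filter [OF assms(4)]
      directed_set_def by blast
  have spec: "real_spectrum T \<subseteq> I" if "spectrum T \<subseteq> complex_of_real ` I" for T :: "'a \<Rightarrow>\<^sub>L 'a"
    using that by (auto simp: real_spectrum_def)
  have H: "\<forall>\<^sub>F i in F. H i \<in> selfadjoint_ops \<and> real_spectrum (H i) \<subseteq> I"
    using in_D by eventually_elim (simp add: assms(5) spec assms(6))
  then have "\<forall>\<^sub>F i in F. H i \<in> selfadjoint_ops" by eventually_elim simp
  then have H0: "H0 \<in> selfadjoint_ops"
    using selfadjoint_weak_limit [OF \<open>F \<noteq> bot\<close> _ assms(7)] assms(9) by (simp add: F_def)
  have spec0: "real_spectrum H0 \<subseteq> I" by (rule spec [OF assms(8)])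
  have strong: "((\<lambda>i. cfc \<phi> (H i) x) \<longlongrightarrow> cfc \<phi> H0 x) F"
    if \<phi>: "continuous_on I \<phi>" "bounded (\<phi> ` I)" for \<phi> x
  proof (cases "\<exists>p\<in>I. \<exists>q\<in>I. p < q")
    case True
    then obtain p q where pq: "p \<in> I" "q \<in> I" "p < q" by blast
    \<comment> \<open>Two further points of I are added so that the hull of \<open>K\<close> is a
      nondegenerate interval even if the spectrum is empty or a single point.\<close>
    define K where "K = insert p (insert q (real_spectrum H0))"
    have K: "compact K" "K \<noteq> {}" "K \<subseteq> I"
      using pq spec0 compact_real_spectrum [OF H0] by (auto simp: K_def)
    obtain a where a: "a \<in> K" "\<forall>t\<in>K. a \<le> t" using compact_attains_inf [OF K(1,2)] by blast
    obtain b where b: "b \<in> K" "\<forall>t\<in>K. t \<le> b" using compact_attains_sup [OF K(1,2)] by blast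
    have "a \<le> p" "q \<le> b" using a b by (auto simp: K_def)
    with pq(3) have "a < b" by linarith
    show ?thesis
    proof (rule strong_convergence [OF assms(1-3) H H0 _ _ \<open>a < b\<close> _ _ _ \<phi>])
      show "a \<in> I" "b \<in> I" using a b K(3) by blast+
      show "real_spectrum H0 \<subseteq> {a..b}" using a(2) b(2) by (auto simp: K_def)
      show "((\<lambda>i. y \<bullet> H i y) \<longlongrightarrow> y \<bullet> H0 y) F" for y
        unfolding F_def by (rule weak_limit_inner [OF assms(9)])
      show "((\<lambda>i. y \<bullet> rfc f (H i) y) \<longlongrightarrow> y \<bullet> rfc f H0 y) F" for y
        unfolding F_def rfc_def by (rule weak_limit_inner [OF assms(10)])
    qed
  next
    case False
    \<comment> \<open>An interval without two distinct points is empty or a singleton, so \<phi> is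
      constant on it and every \<phi>(H_i) is the same multiple of the identity.\<close>
    then have eq: "s = t" if "s \<in> I" "t \<in> I" for s t
      using that by (metis linorder_neqE)
    obtain k where k: "\<And>t. t \<in> I \<Longrightarrow> \<phi> t = k"
    proof (cases "I = {}")
      case False
      then obtain c where "c \<in> I" by blast
      then show ?thesis using eq that by metis
    qed (use that in blast)
    have cfc_k: "cfc \<phi> T x = k *\<^sub>C x" if "T \<in> selfadjoint_ops" "real_spectrum T \<subseteq> I" for T
      using that k by (intro cfc_eq_const) auto
    have "\<forall>\<^sub>F i in F. k *\<^sub>C x = cfc \<phi> (H i) x"
      using H by eventually_elim (simp add: cfc_k)
    then show ?thesis
      unfolding cfc_k [OF H0 spec0] by (rule Lim_transform_eventually [OF tendsto_const])
  qed
  have "((\<lambda>i. H i x) \<longlongrightarrow> H0 x) F" if bdd: "bounded (H ` D)" for x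
  proof -
    obtain M where M: "\<And>i. i \<in> D \<Longrightarrow> norm (H i) \<le> M"
      using bdd unfolding bounded_iff by blast
    \<comment> \<open>The identity truncated to [-L, L] is bounded on I and fixes every
      \<open>H i\<close>; including \<open>norm H0\<close> in L makes it fix \<open>H0\<close> as
      well.\<close>
    define L where "L = max M (norm H0)"
    define \<phi> where "\<phi> t = complex_of_real (max (- L) (min L t))" for t
    have \<phi>: "cfc \<phi> T = T" if "T \<in> selfadjoint_ops" "norm T \<le> L" for T
    proof (rule cfc_eq_self [OF that(1)])
      fix t assume "t \<in> real_spectrum T"
      then have "\<bar>t\<bar> \<le> L" using real_spectrum_le_norm [OF that(1)] that(2) by force
      then show "\<phi> t = complex_of_real t" by (simp add: \<phi>_def)
    qed
    have "continuous_on I \<phi>" unfolding \<phi>_def by (intro continuous_intros)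
    moreover have "cmod (\<phi> t) \<le> \<bar>L\<bar>" for t by (auto simp: \<phi>_def)
    then have "bounded (\<phi> ` I)" by (auto simp: bounded_iff)
    ultimately have lim: "((\<lambda>i. cfc \<phi> (H i) x) \<longlongrightarrow> cfc \<phi> H0 x) F" by (rule strong)
    have "\<forall>\<^sub>F i in F. cfc \<phi> (H i) x = H i x"
      using in_D
    proof eventually_elim
      case (elim i)
      then show ?case using \<phi> [OF assms(5)] M [of i] by (simp add: L_def)
    qed
    moreover have "cfc \<phi> H0 = H0" using \<phi> [OF H0] by (simp add: L_def)
    ultimately show ?thesis using Lim_transform_eventually [OF lim] by simp
  qed
  with strong show ?thesis
    unfolding limitin_strong_operator_topology_iff F_def by blast
qed

end
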